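(* Let $\mathcal{A}=(A,\lambda)$ with $A\in\mathrm{GL}_2^+(F)$ and $\lambda\in\mathrm{Cl}^+(F)$. The class of $A$ in $\Gamma_{1,\lambda}(\mathfrak{n})\backslash\mathrm{GL}_2^+(F)$ is fixed under right multiplication by some upper triangular matrix $A'=\begin{pmatrix}x&y\\0&z\end{pmatrix}\in\mathrm{GL}_2^+(F)$ with $\mathrm{N}(z)<0$ if and only if $\mathcal{A}$ is not admissible.
   Context: $F$ is a totally real number field of degree $n$ with ring of integers $\mathcal{O}_F$, different $\mathfrak{d}$, narrow class group $\mathrm{Cl}^+(F)$, and group of totally positive units $\mathcal{O}_{F,+}^*$. $\mathrm{GL}_2^+(F)$ denotes the $2\times2$ invertible matrices over $F$ with totally positive determinant. Fix an integral ideal $\mathfrak{n}$ (the level) and, for each $\lambda\in\mathrm{Cl}^+(F)$, a fractional ideal $\mathfrak{t}_\lambda$ in the class $\lambda$ that is coprime to $\mathfrak{n}$. Define $\Gamma_{1,\lambda}(\mathfrak{n})$ to be the set of $\begin{pmatrix}a&b\\c&d\end{pmatrix}\in\mathrm{GL}_2^+(F)$ with $a,d\in\mathcal{O}_F$, $c\in\mathfrak{t}_\lambda\mathfrak{d}\mathfrak{n}$, $b\in(\mathfrak{t}_\lambda\mathfrak{d})^{-1}$, $ad-bc\in\mathcal{O}_F^*$ and $d\equiv1\pmod{\mathfrak{n}}$. For a pair $\mathcal{A}=(A,\lambda)$ with $A=\begin{pmatrix}a&b\\c&d\end{pmatrix}\in\mathrm{GL}_2^+(F)$ define the fractional ideal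 $\mathfrak{b}_\mathcal{A}=a\mathcal{O}_F+c(\mathfrak{t}_\lambda\mathfrak{d})^{-1}$, the coprime integral ideals $\mathfrak{a}_\mathcal{A}=a\mathfrak{b}_\mathcal{A}^{-1}$, $\mathfrak{c}_\mathcal{A}=c(\mathfrak{t}_\lambda\mathfrak{d}\mathfrak{b}_\mathcal{A})^{-1}$, and $\mathfrak{m}_\mathcal{A}=\gcd(\mathfrak{c}_\mathcal{A},\mathfrak{n})$. A pair of ideals $(\mathfrak{m},\mathfrak{n})$ with $\mathfrak{m}\mid\mathfrak{n}$ is admissible if there do not exist units $\epsilon_1,\epsilon_2\in\mathcal{O}_F^*$ with $\epsilon_1\equiv1\pmod{\mathfrak{m}}$, $\epsilon_2\equiv1\pmod{\mathfrak{n}/\mathfrak{m}}$, $\mathrm{N}\epsilon_1=\mathrm{N}\epsilon_2=-1$ and $\epsilon_1/\epsilon_2$ totally positive. A pair $\mathcal{A}=(A,\lambda)$ is admissible if $(\mathfrak{m}_\mathcal{A},\mathfrak{n})$ is admissible. *)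

theory Defs
  imports Complex_Main "HOL-Computational_Algebra.Polynomial"
begin

definition is_subfield :: "complex set \<Rightarrow> bool" where
  "is_subfield K \<longleftrightarrow> 0 \<in> K \<and> 1 \<in> K \<and>
     (\<forall>x\<in>K. \<forall>y\<in>K. x + y \<in> K \<and> x - y \<in> K \<and> x * y \<in> K) \<and>
     (\<forall>x\<in>K. x \<noteq> 0 \<longrightarrow> inverse x \<in> K)"

definition number_field :: "complex set \<Rightarrow> bool" where
  "number_field K \<longleftrightarrow> is_subfield K \<and>
     (\<exists>B. finite B \<and> B \<subseteq> K \<and>
        (\<forall>x\<in>K. \<exists>q :: complex \<Rightarrow> rat. x = (\<Sum>b\<in>B. of_rat (q b) * b)))"

definition embeddings :: "complex set \<Rightarrow> (complex \<Rightarrow> complex) set" where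
  "embeddings K = {\<sigma>. \<sigma> 1 = 1 \<and>
       (\<forall>x\<in>K. \<forall>y\<in>K. \<sigma> (x + y) = \<sigma> x + \<sigma> y \<and> \<sigma> (x * y) = \<sigma> x * \<sigma> y) \<and>
       (\<forall>x. x \<notin> K \<longrightarrow> \<sigma> x = 0)}"

definition totally_real :: "complex set \<Rightarrow> bool" where
  "totally_real K \<longleftrightarrow> (\<forall>\<sigma>\<in>embeddings K. \<forall>x\<in>K. \<sigma> x \<in> \<real>)"

text \<open>Norm and trace (product / sum over all embeddings). For a totally real field the
  norm is real; we return its real part.\<close>
definition nf_norm :: "complex set \<Rightarrow> complex \<Rightarrow> real" where
  "nf_norm K x = Re (\<Prod>\<sigma>\<in>embeddings K. \<sigma> x)"

definition nf_trace :: "complex set \<Rightarrow> complex \<Rightarrow> complex" where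
  "nf_trace K x = (\<Sum>\<sigma>\<in>embeddings K. \<sigma> x)"

definition totally_positive :: "complex set \<Rightarrow> complex \<Rightarrow> bool" where
  "totally_positive K x \<longleftrightarrow> x \<in> K \<and> (\<forall>\<sigma>\<in>embeddings K. \<sigma> x \<in> \<real> \<and> Re (\<sigma> x) > 0)"

definition algebraic_integer :: "complex \<Rightarrow> bool" where
  "algebraic_integer x \<longleftrightarrow>
     (\<exists>p :: int poly. lead_coeff p = 1 \<and> poly (map_poly of_int p) x = 0)"

definition ring_of_integers :: "complex set \<Rightarrow> complex set" where
  "ring_of_integers K = {x\<in>K. algebraic_integer x}"

definition nf_units :: "complex set \<Rightarrow> complex set" where
  "nf_units K = {x\<in>ring_of_integers K. x \<noteq> 0 \<and> inverse x \<in> ring_of_integers K}"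

definition frac_ideal :: "complex set \<Rightarrow> complex set \<Rightarrow> bool" where
  "frac_ideal K I \<longleftrightarrow> I \<subseteq> K \<and> 0 \<in> I \<and> I \<noteq> {0} \<and>
     (\<forall>x\<in>I. \<forall>y\<in>I. x + y \<in> I) \<and>
     (\<forall>r\<in>ring_of_integers K. \<forall>x\<in>I. r * x \<in> I) \<and>
     (\<exists>d\<in>ring_of_integers K. d \<noteq> 0 \<and> (\<forall>x\<in>I. d * x \<in> ring_of_integers K))"

definition int_ideal :: "complex set \<Rightarrow> complex set \<Rightarrow> bool" where
  "int_ideal K I \<longleftrightarrow> frac_ideal K I \<and> I \<subseteq> ring_of_integers K"

definition fideal_add :: "complex set \<Rightarrow> complex set \<Rightarrow> complex set" where
  "fideal_add I J = {x + y | x y. x \<in> I \<and> y \<in> J}"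

definition fideal_mult :: "complex set \<Rightarrow> complex set \<Rightarrow> complex set" where
  "fideal_mult I J = {(\<Sum>k<m. a k * b k) | (m::nat) a b. \<forall>k<m. a k \<in> I \<and> b k \<in> J}"

definition fideal_inv :: "complex set \<Rightarrow> complex set \<Rightarrow> complex set" where
  "fideal_inv K I = {x\<in>K. \<forall>y\<in>I. x * y \<in> ring_of_integers K}"

definition elt_mult :: "complex \<Rightarrow> complex set \<Rightarrow> complex set" where
  "elt_mult x I = {x * y | y. y \<in> I}"

definition different :: "complex set \<Rightarrow> complex set" where
  "different K = fideal_inv K {x\<in>K. \<forall>y\<in>ring_of_integers K. nf_trace K (x * y) \<in> \<int>}"

definition coprime_to :: "complex set \<Rightarrow> complex set \<Rightarrow> complex set \<Rightarrow> bool" where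
  "coprime_to K t n \<longleftrightarrow> (\<exists>a b. int_ideal K a \<and> int_ideal K b \<and>
      fideal_add a n = ring_of_integers K \<and> fideal_add b n = ring_of_integers K \<and>
      t = fideal_mult a (fideal_inv K b))"

definition cong_mod :: "complex \<Rightarrow> complex \<Rightarrow> complex set \<Rightarrow> bool" where
  "cong_mod x y I \<longleftrightarrow> x - y \<in> I"

section \<open>2x2 matrices over K, written (a, b, c, d) for [[a, b], [c, d]]\<close>

type_synonym mat2 = "complex \<times> complex \<times> complex \<times> complex"

fun mat2_mult :: "mat2 \<Rightarrow> mat2 \<Rightarrow> mat2" where
  "mat2_mult (a, b, c, d) (a', b', c', d') =
     (a * a' + b * c', a * b' + b * d', c * a' + d * c', c * b' + d * d')"

fun mat2_det :: "mat2 \<Rightarrow> complex" where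
  "mat2_det (a, b, c, d) = a * d - b * c"

definition GL2_plus :: "complex set \<Rightarrow> mat2 set" where
  "GL2_plus K = {(a, b, c, d). a \<in> K \<and> b \<in> K \<and> c \<in> K \<and> d \<in> K \<and>
                   totally_positive K (a * d - b * c)}"

text \<open>Gamma_{1,lambda}(n), with t = t_lambda.\<close>
definition Gamma1 :: "complex set \<Rightarrow> complex set \<Rightarrow> complex set \<Rightarrow> mat2 set" where
  "Gamma1 K t n = {(a, b, c, d) \<in> GL2_plus K.
      a \<in> ring_of_integers K \<and> d \<in> ring_of_integers K \<and>
      c \<in> fideal_mult (fideal_mult t (different K)) n \<and>
      b \<in> fideal_inv K (fideal_mult t (different K)) \<and>
      a * d - b * c \<in> nf_units K \<and> cong_mod d 1 n}"

definition left_coset :: "mat2 set \<Rightarrow> mat2 \<Rightarrow> mat2 set" where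
  "left_coset G M = {mat2_mult g M | g. g \<in> G}"

fun b_ideal :: "complex set \<Rightarrow> complex set \<Rightarrow> mat2 \<Rightarrow> complex set" where
  "b_ideal K t (a, b, c, d) =
     fideal_add (elt_mult a (ring_of_integers K))
               (elt_mult c (fideal_inv K (fideal_mult t (different K))))"

fun a_ideal :: "complex set \<Rightarrow> complex set \<Rightarrow> mat2 \<Rightarrow> complex set" where
  "a_ideal K t (a, b, c, d) = elt_mult a (fideal_inv K (b_ideal K t (a, b, c, d)))"

fun c_ideal :: "complex set \<Rightarrow> complex set \<Rightarrow> mat2 \<Rightarrow> complex set" where
  "c_ideal K t (a, b, c, d) =
     elt_mult c (fideal_inv K (fideal_mult (fideal_mult t (different K)) (b_ideal K t (a, b, c, d))))"

definition m_ideal :: "complex set \<Rightarrow> complex set \<Rightarrow> complex set \<Rightarrow> mat2 \<Rightarrow> complex set" where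
  "m_ideal K t n A = fideal_add (c_ideal K t A) n"

text \<open>Admissibility of a pair (m, n) with m | n; n/m is n * m^{-1}.\<close>
definition admissible_pair :: "complex set \<Rightarrow> complex set \<Rightarrow> complex set \<Rightarrow> bool" where
  "admissible_pair K m n \<longleftrightarrow>
     \<not> (\<exists>e1 e2. e1 \<in> nf_units K \<and> e2 \<in> nf_units K \<and>
          cong_mod e1 1 m \<and> cong_mod e2 1 (fideal_mult n (fideal_inv K m)) \<and>
          nf_norm K e1 = -1 \<and> nf_norm K e2 = -1 \<and> totally_positive K (e1 / e2))"

definition admissible :: "complex set \<Rightarrow> complex set \<Rightarrow> complex set \<Rightarrow> mat2 \<Rightarrow> bool" where
  "admissible K t n A \<longleftrightarrow> admissible_pair K (m_ideal K t n A) n"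

end

theory Submission
  imports Defs
    "HOL-Computational_Algebra.Formal_Power_Series"
    "HOL-Computational_Algebra.Fundamental_Theorem_Algebra"
begin

text \<open>
  If \<open>\<gamma> A = A A'\<close> with \<open>\<gamma> \<in> \<Gamma>\<close> and \<open>A' = (x, y, 0, z)\<close>, then the first column \<open>(a, c)\<close> of \<open>A\<close> is an
  eigenvector of \<open>\<gamma>\<close> for \<open>x\<close>, and \<open>(- c, a)\<close> is a left eigenvector for \<open>z\<close>. Writing
  \<open>\<qq> = \<tt>\<dd>\<close>, the matrix \<open>\<gamma>\<close> stabilises the lattice \<open>\<O> \<oplus> \<qq>\<close>, its submodule \<open>\<bb>\<^sup>-\<^sup>1(a, c)\<close> and the quotient by
  it; hence \<open>x\<close> and \<open>z\<close> are units, and since \<open>\<gamma>\<close> acts trivially on \<open>\<qq> / \<nn>\<qq>\<close> one gets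
  \<open>x \<equiv> 1 (mod \<nn>/\<mm>)\<close> and \<open>z \<equiv> 1 (mod \<mm>)\<close>. Conversely, the submodule has a complement, which yields
  a \<open>\<gamma>\<close> with prescribed eigenvalues; its off-diagonal entry is chosen so that the lower row
  satisfies the congruences of \<open>\<Gamma>\<close>.

  The arithmetic input is that the different and all fractional ideals are invertible and that
  units have norm \<open>\<plusminus> 1\<close>. Rationality of the trace holds because every \<open>\<rat>\<close>-linear functional on \<open>K\<close> is
  a combination of embeddings (decompose it into joint eigenvectors of the multiplications), so
  that the sum of the embeddings is the trace of the multiplication matrix.
\<close>

section \<open>Finitely generated additive groups and algebraic integers\<close>

text \<open>The vector \<open>(- c, a)\<close> comes from \<open>(- c, a) A = (0, det A)\<close>:
  applied to \<open>\<gamma> A = A A'\<close> it yields \<open>(0, z det A)\<close>, hence the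
  eigenvalue z. Conversely, if \<gamma> has both eigenvectors, then \<open>A^-1 \<gamma> A\<close>
  is upper triangular with diagonal x, z, so y comes for free and only \<gamma> has to be
  constructed. In the definition of admissibility, \<open>e1\<close> is z and \<open>e2\<close> is
  x. For a unit, negative norm means norm -1; as x z is totally positive, x then has norm -1 too,
  and x z and z / x differ by a square. The obstacle is that the embeddings are given only as the
  set of all homomorphisms to the complex numbers, with no count of them. The argument replaces a
  primitive element or a normal closure by linear algebra on the dual of K. Once the trace is
  integral on \<O> and nondegenerate, the codifferent is finitely generated, hence so is \<O>, and
  both integral closedness and the finiteness arguments for ideals rest on this.\<close>

interpretation Z: module "\<lambda>(k::int) (x::complex). of_int k * x"
  by unfold_locales (auto simp: algebra_simps)

interpretation Q: vector_space "\<lambda>(q::rat) (x::complex). of_rat q * x"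
  by unfold_locales (auto simp: algebra_simps of_rat_add of_rat_mult)

definition fg :: "complex set \<Rightarrow> bool" where
  "fg M \<longleftrightarrow> (\<exists>S. finite S \<and> M = Z.span S)"

section \<open>Subgroups of finitely generated groups\<close>

lemma int_subgroup_principal:
  fixes P :: "int set"
  assumes "0 \<in> P" and sub: "\<And>k l c. k \<in> P \<Longrightarrow> l \<in> P \<Longrightarrow> k - c * l \<in> P"
  obtains g where "g \<in> P" "\<And>k. k \<in> P \<Longrightarrow> g dvd k"
proof (cases "P \<subseteq> {0}")
  case True
  then show ?thesis using that assms(1) by auto
next
  case False
  then obtain k where k: "k \<in> P" "k \<noteq> 0" by auto
  have "0 - 1 * k \<in> P" using sub[OF assms(1) k(1), of 1] by simp
  then have ex: "\<exists>n::nat. n > 0 \<and> int n \<in> P"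
    using k by (intro exI[of _ "nat \<bar>k\<bar>"]) (auto simp: abs_if)
  define g where "g = (LEAST n::nat. n > 0 \<and> int n \<in> P)"
  have g: "g > 0" "int g \<in> P" using LeastI_ex[OF ex] by (auto simp: g_def)
  have "int g dvd k" if "k \<in> P" for k
  proof -
    have "k - (k div int g) * int g \<in> P" using sub that g by blast
    then have "k mod int g \<in> P" by (simp add: minus_div_mult_eq_mod)
    moreover have "0 \<le> k mod int g" "k mod int g < int g" using g by auto
    ultimately have "\<not> 0 < nat (k mod int g)"
      using not_less_Least[of "nat (k mod int g)" "\<lambda>n::nat. n > 0 \<and> int n \<in> P"]
      by (auto simp: g_def)
    then show ?thesis using \<open>0 \<le> k mod int g\<close> by auto
  qed
  then show ?thesis using that g by blast
qed

text \<open>The relation \<open>r\<close> plays the role of a homomorphism to the integers that is only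
  defined up to the choice of a representation.\<close>
lemma fg_extension:
  assumes H: "Z.subspace H"
    and ex: "\<And>h. h \<in> H \<Longrightarrow> \<exists>k::int. r h k"
    and r: "\<And>h h' k k' c. \<lbrakk>h \<in> H; h' \<in> H; r h k; r h' k'\<rbrakk> \<Longrightarrow> r (h - of_int c * h') (k - c * k')"
    and ker: "fg {h \<in> H. r h 0}"
  shows "fg H"
proof -
  define P where "P = {k. \<exists>h\<in>H. r h k}"
  have mem: "h - of_int c * h' \<in> H" if "h \<in> H" "h' \<in> H" for h h' c
    using that H by (simp add: Z.subspace_diff Z.subspace_scale)
  have "0 \<in> P"
  proof -
    have "0 \<in> H" using H by (rule Z.subspace_0)
    moreover obtain k where "r 0 k" using ex \<open>0 \<in> H\<close> by blast
    \<comment> \<open>\<open>r\<close> need not be single-valued, so \<open>r 0 0\<close> is won by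
      subtracting a value from itself.\<close>
    ultimately have "r (0 - of_int 1 * 0) (k - 1 * k)" using r by blast
    then show ?thesis using \<open>0 \<in> H\<close> by (auto simp: P_def)
  qed
  moreover have "k - c * l \<in> P" if "k \<in> P" "l \<in> P" for k l c
    using that r mem unfolding P_def by blast
  ultimately obtain g where g: "g \<in> P" "\<And>k. k \<in> P \<Longrightarrow> g dvd k"
    using int_subgroup_principal by blast
  then obtain h0 where h0: "h0 \<in> H" "r h0 g" by (auto simp: P_def)
  obtain T where T: "finite T" "{h \<in> H. r h 0} = Z.span T" using ker by (auto simp: fg_def)
  have "H = Z.span (insert h0 T)"
  proof
    show "H \<subseteq> Z.span (insert h0 T)"
    proof
      fix h assume h: "h \<in> H"
      then obtain k where k: "r h k" using ex by blast
      with h have "k \<in> P" by (auto simp: P_def)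
      then obtain c where "k = g * c" using g by blast
      then have "r (h - of_int c * h0) 0" using r[OF h h0(1) k h0(2), of c] by (simp add: mult.commute)
      then have "h - of_int c * h0 \<in> Z.span T" using mem[OF h h0(1)] T by blast
      then show "h \<in> Z.span (insert h0 T)" by (auto simp: Z.span_breakdown_eq)
    qed
    have "T \<subseteq> H" using T Z.span_superset by blast
    then show "Z.span (insert h0 T) \<subseteq> H" using h0 H by (intro Z.span_minimal) auto
  qed
  then show ?thesis using T by (auto simp: fg_def)
qed

lemma fg_subspace: "fg M \<Longrightarrow> Z.subspace M"
  by (auto simp: fg_def)

text \<open>Induction on the generators, reading off the coefficient of the last one,
  \<open>g\<close>. Dependent generators make this coefficient ambiguous, hence the relation in
  \<open>fg_extension\<close>; its kernel lies in the span of the other generators.\<close>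

lemma fg_subgroup:
  assumes "fg M" "Z.subspace H" "H \<subseteq> M"
  shows "fg H"
proof -
  have "fg H" if "finite S" "Z.subspace H" "H \<subseteq> Z.span S" for S H
    using that
  proof (induction S arbitrary: H)
    case empty
    then have "H = Z.span {}" using Z.subspace_0 by auto
    then show ?case unfolding fg_def by blast
  next
    case (insert g S)
    show ?case
    proof (rule fg_extension[where r = "\<lambda>h k. h - of_int k * g \<in> Z.span S"])
      show "\<exists>k. h - of_int k * g \<in> Z.span S" if "h \<in> H" for h
        using that insert.prems by (auto simp: Z.span_breakdown_eq)
      show "h - of_int c * h' - of_int (k - c * k') * g \<in> Z.span S"
        if "h - of_int k * g \<in> Z.span S" "h' - of_int k' * g \<in> Z.span S" for h h' k k' c
        using Z.span_diff[OF that(1) Z.span_scale[OF that(2), of c]] by (simp add: algebra_simps)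
      have "Z.subspace {h \<in> H. h - of_int 0 * g \<in> Z.span S}"
        using insert.prems Z.subspace_inter[OF insert.prems(1) Z.subspace_span[of S]]
        by (simp add: Int_def)
      then show "fg {h \<in> H. h - of_int 0 * g \<in> Z.span S}" by (intro insert.IH) auto
    qed (use insert.prems in auto)
  qed
  then show ?thesis using assms by (auto simp: fg_def)
qed

text \<open>The maps in \<open>F\<close> embed \<open>M\<close> into a power of the integers. The
  kernel of one map is separated by the remaining ones, which is the induction step. The codifferent
  is the intended \<open>M\<close>.\<close>

lemma fg_if_separated:
  assumes "finite F" and "Z.subspace M"
    and "\<And>f x y. \<lbrakk>f \<in> F; x \<in> M; y \<in> M\<rbrakk> \<Longrightarrow> f (x + y) = (f x + f y :: int)"
    and "\<And>x. \<lbrakk>x \<in> M; \<forall>f\<in>F. f x = 0\<rbrakk> \<Longrightarrow> x = 0"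
  shows "fg M"
  using assms
proof (induction F arbitrary: M)
  case empty
  then have "M = Z.span {}" using Z.subspace_0 by auto
  then show ?case unfolding fg_def by blast
next
  case (insert f F)
  have mem: "of_int c * x \<in> M" if "x \<in> M" for x c
    using that insert.prems(1) by (rule Z.subspace_scale[rotated])
  have add: "f' (x + y) = f' x + f' y" if "f' \<in> insert f F" "x \<in> M" "y \<in> M" for f' x y
    using insert.prems(2) that by blast
  have zero: "f' 0 = 0" if "f' \<in> insert f F" for f'
    using add[of f' 0 0] that Z.subspace_0[OF insert.prems(1)] by simp
  have neg: "f' (- x) = - f' x" if "f' \<in> insert f F" "x \<in> M" for f' x
    using add[of f' x "-x"] zero that Z.subspace_neg[OF insert.prems(1)] by fastforce
  have nat: "f (of_nat n * x) = int n * f x" if "x \<in> M" for n x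
  proof (induction n)
    case (Suc n)
    have "of_nat n * x \<in> M" using mem[OF that, of "int n"] by simp
    then have "f (of_nat n * x + x) = f (of_nat n * x) + f x" using add that by blast
    then show ?case using Suc by (simp add: algebra_simps)
  qed (simp add: zero)
  have int: "f (of_int c * x) = c * f x" if "x \<in> M" for c x
  proof (cases c rule: int_cases2)
    case (nonneg n) then show ?thesis using nat[OF that] by simp
  next
    case (nonpos n)
    have "of_nat n * x \<in> M" using mem[OF that, of "int n"] by simp
    with nonpos show ?thesis using nat[OF that, of n] neg[of f "of_nat n * x"] by simp
  qed
  show ?case
  proof (rule fg_extension[where r = "\<lambda>h k. f h = k"])
    show "f (h - of_int c * h') = k - c * k'" if "h \<in> M" "h' \<in> M" "f h = k" "f h' = k'" for h h' k k' c
      using add[of f h "- (of_int c * h')"] neg[of f "of_int c * h'"] int[of h' c] mem[of h' c] that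
        Z.subspace_neg[OF insert.prems(1), of "of_int c * h'"] by simp
    show "fg {h \<in> M. f h = 0}"
    proof (rule insert.IH)
      show "Z.subspace {h \<in> M. f h = 0}"
        using insert.prems(1) zero[of f] add[of f] int by (simp add: Z.subspace_def)
    qed (use insert.prems in auto)
  qed (use insert.prems in auto)
qed

section \<open>Algebraic integers form a ring\<close>

lemma map_poly_of_int_add:
  "map_poly of_int (p + q) = map_poly of_int p + (map_poly of_int q :: 'a::ring_1 poly)"
  and map_poly_of_int_diff:
  "map_poly of_int (p - q) = map_poly of_int p - (map_poly of_int q :: 'a::ring_1 poly)"
  by (simp_all add: poly_eq_iff coeff_map_poly)

text \<open>A determinant-free integrality criterion: the span of all \<open>y ^ k * m\<close> is finitely
  generated, hence spanned by finitely many of them.\<close>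
lemma algebraic_integerI_fg:
  assumes "fg M" "m \<noteq> 0" "\<And>k. y ^ k * m \<in> M"
  shows "algebraic_integer y"
proof -
  define P where "P = (\<lambda>k. y ^ k * m)"
  have sub: "Z.span (range P) \<subseteq> M"
    using assms fg_subspace by (intro Z.span_minimal) (auto simp: P_def)
  obtain T where T: "finite T" "Z.span (range P) = Z.span T"
    using fg_subgroup[OF assms(1) Z.subspace_span sub] by (auto simp: fg_def)
  have "\<exists>N. x \<in> Z.span (P ` {..<N})" if "x \<in> Z.span (range P)" for x
    using that
  proof (induction rule: Z.span_induct_alt)
    case base
    then show ?case by (auto intro: Z.span_zero)
  next
    case (step c x z)
    then obtain N k where N: "z \<in> Z.span (P ` {..<N})" and k: "x = P k" by auto
    have "z \<in> Z.span (P ` {..<max N (Suc k)})" using N by (rule rev_subsetD) (intro Z.span_mono image_mono; auto)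
    moreover have "x \<in> Z.span (P ` {..<max N (Suc k)})" unfolding k by (intro Z.span_base) auto
    ultimately show ?case by (blast intro: Z.span_add Z.span_scale)
  qed
  moreover have "x \<in> Z.span (range P)" if "x \<in> T" for x using T Z.span_superset that by blast
  ultimately obtain N where N: "\<And>x. x \<in> T \<Longrightarrow> x \<in> Z.span (P ` {..<N x})" by metis
  define L where "L = (\<Sum>x\<in>T. N x)"
  have "T \<subseteq> Z.span (P ` {..<L})"
  proof
    fix x assume x: "x \<in> T"
    then have "N x \<le> L" unfolding L_def using T by (intro member_le_sum) auto
    then show "x \<in> Z.span (P ` {..<L})" using N[OF x] by (elim rev_subsetD) (intro Z.span_mono image_mono; auto)
  qed
  then have "P L \<in> Z.span (P ` {..<L})"
    using T(2) Z.span_minimal[OF _ Z.subspace_span] Z.span_base[of "P L" "range P"] by blast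
  \<comment> \<open>The zero polynomial has degree 0, so for \<open>L = 0\<close> a bound
    \<open>degree q < L\<close> would exclude even it; that case is stated separately.\<close>
  moreover have "\<exists>q :: int poly. (L = 0 \<longrightarrow> q = 0) \<and> (L \<noteq> 0 \<longrightarrow> degree q < L) \<and> x = poly (map_poly of_int q) y * m"
    if "x \<in> Z.span (P ` {..<L})" for x
    using that
  proof (induction rule: Z.span_induct_alt)
    case base
    then show ?case by (intro exI[of _ 0]) auto
  next
    case (step c x z)
    from step.hyps(1) obtain k where k: "k < L" "x = P k" by blast
    then obtain q where q: "degree q < L" "z = poly (map_poly of_int q) y * m" using step.IH by auto
    have "poly (map_poly of_int (monom c k)) y = of_int c * y ^ k"
      by (simp add: map_poly_monom poly_monom)
    then have "of_int c * x + z = poly (map_poly of_int (monom c k + q)) y * m"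
      using k q by (simp add: P_def map_poly_of_int_add algebra_simps)
    moreover have "degree (monom c k + q) < L"
      using k q degree_monom_le[of c k] by (intro degree_add_less) auto
    ultimately show ?case using k by (intro exI[of _ "monom c k + q"]) auto
  qed
  ultimately obtain q :: "int poly" where q: "L = 0 \<longrightarrow> q = 0" "L \<noteq> 0 \<longrightarrow> degree q < L" 
    "P L = poly (map_poly of_int q) y * m" by blast
  define p where "p = monom 1 L - q"
  have "coeff q L = 0" using q(1,2) by (cases "L = 0") (auto simp: coeff_eq_0)
  then have "coeff p L = 1" by (simp add: p_def)
  moreover have "degree p \<le> L" unfolding p_def using q(1,2)
    by (intro degree_diff_le) (auto simp: degree_monom_le)
  ultimately have "lead_coeff p = 1" by (metis le_antisym le_degree zero_neq_one)
  moreover have "poly (map_poly of_int p) y * m = 0"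
    using q(3) by (simp add: p_def P_def map_poly_of_int_diff map_poly_monom poly_monom algebra_simps)
  ultimately show ?thesis using assms(2) by (auto simp: algebraic_integer_def)
qed

lemma algebraic_integer_iff: "algebraic_integer x \<longleftrightarrow> algebraic_int x"
  by (auto simp: algebraic_integer_def algebraic_int_altdef_ipoly)

lemma algebraic_integer_power_relation:
  assumes "algebraic_integer x"
  obtains d and c :: "nat \<Rightarrow> int" where "x ^ d = (\<Sum>i<d. of_int (c i) * x ^ i)"
proof -
  obtain p :: "int poly" where p: "lead_coeff p = 1" "poly (map_poly of_int p) x = 0"
    using assms by (auto simp: algebraic_integer_def)
  have "(\<Sum>i\<le>degree p. of_int (coeff p i) * x ^ i) = 0"
    using p(2) by (simp add: poly_altdef coeff_map_poly degree_map_poly)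
  then have "x ^ degree p + (\<Sum>i<degree p. of_int (coeff p i) * x ^ i) = 0"
    using p(1) by (simp add: lessThan_Suc_atMost[symmetric] add.commute)
  then have "x ^ degree p = - (\<Sum>i<degree p. of_int (coeff p i) * x ^ i)"
    unfolding eq_neg_iff_add_eq_0 .
  also have "\<dots> = (\<Sum>i<degree p. of_int (- coeff p i) * x ^ i)"
    by (simp add: sum_negf)
  finally have "x ^ degree p = \<dots>" .
  then show ?thesis by (rule that)
qed

text \<open>The monomials in x and y below the degrees of the two monic relations span a ring-like
  lattice. It is then stable under x + y and x y as well, so the integrality criterion applies to
  both.\<close>

lemma algebraic_integer_common_lattice:
  assumes "algebraic_integer x" "algebraic_integer y"
  obtains M where "fg M" "1 \<in> M" "\<And>u. u \<in> M \<Longrightarrow> x * u \<in> M" "\<And>u. u \<in> M \<Longrightarrow> y * u \<in> M"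
proof -
  obtain d c where x: "x ^ d = (\<Sum>i<d. of_int (c i :: int) * x ^ i)"
    using algebraic_integer_power_relation[OF assms(1)] by blast
  obtain e b where y: "y ^ e = (\<Sum>i<e. of_int (b i :: int) * y ^ i)"
    using algebraic_integer_power_relation[OF assms(2)] by blast
  \<comment> \<open>\<open>max 1\<close> keeps the monomial 1 in \<open>S\<close>; a relation with
    \<open>d = 0\<close> or \<open>e = 0\<close> would say 1 = 0 and is refuted when it comes
    up.\<close>
  define S where "S = (\<lambda>(i, j). x ^ i * y ^ j) ` ({..<max 1 d} \<times> {..<max 1 e})"
  have base: "x ^ i * y ^ j \<in> Z.span S" if "i < max 1 d" "j < max 1 e" for i j
    using that by (intro Z.span_base) (auto simp: S_def)
  have mx: "x * (x ^ i * y ^ j) \<in> Z.span S" if "i < max 1 d" "j < max 1 e" for i j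
  proof (cases "Suc i < max 1 d")
    case True then show ?thesis using base[of "Suc i" j] that by (simp add: algebra_simps)
  next
    case False
    show ?thesis
    proof (cases "d = 0")
      case True
      then show ?thesis using x by (auto intro: Z.span_zero)
    next
      case d: False
      then have "Suc i = d" using False that by auto
      then have "x * (x ^ i * y ^ j) = x ^ d * y ^ j" by auto
      also have "\<dots> = (\<Sum>k<d. of_int (c k) * (x ^ k * y ^ j))" by (subst x) (simp add: sum_distrib_right mult.assoc)
      also have "\<dots> \<in> Z.span S" using base that by (intro Z.span_sum Z.span_scale) auto
      finally show ?thesis .
    qed
  qed
  have my: "y * (x ^ i * y ^ j) \<in> Z.span S" if "i < max 1 d" "j < max 1 e" for i j
  proof (cases "Suc j < max 1 e")
    case True then show ?thesis using base[of i "Suc j"] that by (simp add: algebra_simps)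
  next
    case False
    show ?thesis
    proof (cases "e = 0")
      case True
      then show ?thesis using y by (auto intro: Z.span_zero)
    next
      case d: False
      then have "Suc j = e" using False that by auto
      then have "y * (x ^ i * y ^ j) = x ^ i * y ^ e" by auto
      also have "\<dots> = (\<Sum>k<e. of_int (b k) * (x ^ i * y ^ k))"
        by (subst y) (simp add: sum_distrib_left algebra_simps)
      also have "\<dots> \<in> Z.span S" using base that by (intro Z.span_sum Z.span_scale) auto
      finally show ?thesis .
    qed
  qed
  have closed: "w * u \<in> Z.span S" if "\<And>s. s \<in> S \<Longrightarrow> w * s \<in> Z.span S" "u \<in> Z.span S" for w u
    using that(2)
  proof (induction rule: Z.span_induct_alt)
    case base then show ?case by (auto intro: Z.span_zero)
  next
    case (step c s z)
    have "of_int c * (w * s) + w * z \<in> Z.span S" using step that(1) by (blast intro: Z.span_add Z.span_scale)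
    then show ?case by (simp add: algebra_simps)
  qed
  show ?thesis
  proof
    have "finite S" by (simp add: S_def)
    then show "fg (Z.span S)" unfolding fg_def by (intro exI[of _ S] conjI refl)
    show "1 \<in> Z.span S" using base[of 0 0] by simp
    show "x * u \<in> Z.span S" if "u \<in> Z.span S" for u
    proof (rule closed[OF _ that])
      fix s assume "s \<in> S"
      then obtain i j where "s = x ^ i * y ^ j" "i < max 1 d" "j < max 1 e" unfolding S_def by auto
      then show "x * s \<in> Z.span S" using mx by simp
    qed
    show "y * u \<in> Z.span S" if "u \<in> Z.span S" for u
    proof (rule closed[OF _ that])
      fix s assume "s \<in> S"
      then obtain i j where "s = x ^ i * y ^ j" "i < max 1 d" "j < max 1 e" unfolding S_def by auto
      then show "y * s \<in> Z.span S" using my by simp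
    qed
  qed
qed

lemma
  assumes "algebraic_integer x" "algebraic_integer y"
  shows algebraic_integer_add: "algebraic_integer (x + y)"
    and algebraic_integer_mult: "algebraic_integer (x * y)"
proof -
  obtain M where M: "fg M" "1 \<in> M" "\<And>u. u \<in> M \<Longrightarrow> x * u \<in> M" "\<And>u. u \<in> M \<Longrightarrow> y * u \<in> M"
    using algebraic_integer_common_lattice[OF assms] by blast
  have "(x + y) ^ k * 1 \<in> M" for k
  proof (induction k)
    case (Suc k)
    then have "x * (x + y) ^ k + y * (x + y) ^ k \<in> M" using M Z.subspace_add[OF fg_subspace[OF M(1)]] by auto
    then show ?case by (simp add: algebra_simps)
  qed (use M in auto)
  then show "algebraic_integer (x + y)" using algebraic_integerI_fg[OF M(1), of 1] by auto
  have "(x * y) ^ k * 1 \<in> M" for k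
  proof (induction k)
    case (Suc k)
    then have "x * (y * (x * y) ^ k) \<in> M" using M by auto
    then show ?case by (simp add: algebra_simps)
  qed (use M in auto)
  then show "algebraic_integer (x * y)" using algebraic_integerI_fg[OF M(1), of 1] by auto
qed

lemma algebraic_integer_of_int [simp]: "algebraic_integer (of_int k)"
  by (simp add: algebraic_integer_iff int_imp_algebraic_int)

lemma algebraic_integer_0 [simp]: "algebraic_integer 0"
  and algebraic_integer_1 [simp]: "algebraic_integer 1"
  using algebraic_integer_of_int[of 0] algebraic_integer_of_int[of 1] by simp_all

lemma algebraic_integer_minus: "algebraic_integer x \<Longrightarrow> algebraic_integer (- x)"
  by (auto simp: algebraic_integer_iff)

lemma algebraic_integer_prod:
  "(\<And>i. i \<in> I \<Longrightarrow> algebraic_integer (f i)) \<Longrightarrow> algebraic_integer (\<Prod>i\<in>I. f i)"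
  by (induction I rule: infinite_finite_induct) (auto intro: algebraic_integer_mult)

lemma algebraic_integer_sum:
  "(\<And>i. i \<in> I \<Longrightarrow> algebraic_integer (f i)) \<Longrightarrow> algebraic_integer (\<Sum>i\<in>I. f i)"
  by (induction I rule: infinite_finite_induct) (auto intro: algebraic_integer_add)

section \<open>Number fields and their embeddings\<close>

lemma common_denominator:
  fixes R :: "rat set"
  assumes "finite R"
  obtains d :: nat where "d > 0" "\<And>r. r \<in> R \<Longrightarrow> \<exists>k::int. of_nat d * r = of_int k"
proof -
  have "\<exists>d::nat. d > 0 \<and> (\<forall>r\<in>R. \<exists>k::int. of_nat d * r = of_int k)"
    using assms
  proof induction
    case empty
    then show ?case by auto
  next
    case (insert r R)
    then obtain d :: nat where d: "d > 0" "\<And>r. r \<in> R \<Longrightarrow> \<exists>k::int. of_nat d * r = of_int k" by auto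
    obtain a b where r: "r = Fract a b" "b > 0" by (cases r) auto
    have "of_nat (d * nat b) * r = of_int (int d * a)"
      using r by (simp add: Fract_of_int_quotient)
    moreover have "\<exists>k::int. of_nat (d * nat b) * s = of_int k" if "s \<in> R" for s
    proof -
      obtain k :: int where "of_nat d * s = of_int k" using d(2) \<open>s \<in> R\<close> by blast
      then have "of_nat (d * nat b) * s = of_int (int (nat b) * k)"
        by (simp add: mult.commute mult.left_commute)
      then show ?thesis by blast
    qed
    moreover have "d * nat b > 0" using d r by auto
    ultimately show ?case by (intro exI[of _ "d * nat b"]) blast
  qed
  then show ?thesis using that by blast
qed

text \<open>Newton's identities as a logarithmic derivative: \<open>F\<close> is the product of the
  \<open>1 - f i X\<close>, \<open>H\<close> generates the power sums, and
  \<open>F' = - F H\<close>. Comparing coefficients gives those of \<open>F\<close> recursively, and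
  the top one is the product up to sign. This will deduce rational norms from rational
  traces.\<close>

lemma prod_Rats_if_power_sums_Rats:
  includes fps_syntax
  fixes f :: "'a \<Rightarrow> complex"
  assumes "finite S" and "\<And>k. (\<Sum>i\<in>S. f i ^ Suc k) \<in> \<rat>"
  shows "(\<Prod>i\<in>S. f i) \<in> \<rat>"
proof -
  define F where "F = (\<lambda>S. \<Prod>i\<in>S. 1 - fps_const (f i) * fps_X)"
  define H where "H = (\<lambda>S. Abs_fps (\<lambda>n. \<Sum>i\<in>S. f i ^ Suc n))"
  have geom: "(1 - fps_const (f i) * fps_X) * Abs_fps (\<lambda>n. f i ^ Suc n) = fps_const (f i)" for i
  proof (rule fps_ext)
    show "((1 - fps_const (f i) * fps_X) * Abs_fps (\<lambda>n. f i ^ Suc n)) $ n = fps_const (f i) $ n" for n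
      by (cases n) (simp_all add: left_diff_distrib mult.assoc)
  qed
  have log_deriv: "fps_deriv (F S) = - F S * H S" using assms(1)
  proof induction
    case empty
    then show ?case by (simp add: F_def H_def fps_eq_iff)
  next
    case (insert i S)
    have FI: "F (insert i S) = (1 - fps_const (f i) * fps_X) * F S"
      using insert by (simp add: F_def)
    have HI: "H (insert i S) = Abs_fps (\<lambda>n. f i ^ Suc n) + H S"
      using insert by (simp add: H_def fps_eq_iff)
    have "fps_deriv (F (insert i S)) = (1 - fps_const (f i) * fps_X) * fps_deriv (F S) - fps_const (f i) * F S"
      unfolding FI by (simp add: algebra_simps)
    also have "\<dots> = - F (insert i S) * H S - ((1 - fps_const (f i) * fps_X) * Abs_fps (\<lambda>n. f i ^ Suc n)) * F S"
      unfolding insert.IH FI geom by (simp add: algebra_simps)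
    also have "\<dots> = - F (insert i S) * H (insert i S)"
      unfolding FI HI by (simp add: algebra_simps)
    finally show ?case .
  qed
  have rat: "F S $ n \<in> \<rat>" for n
  proof (induction n rule: less_induct)
    case (less n)
    show ?case
    proof (cases n)
      case 0
      have "F S $ 0 = 1" using assms(1) by induction (simp_all add: F_def)
      then show ?thesis using 0 by simp
    next
      case (Suc m)
      have "of_nat (Suc m) * F S $ n = fps_deriv (F S) $ m" using Suc by simp
      also have "\<dots> = - (\<Sum>i=0..m. F S $ i * H S $ (m - i))"
        unfolding log_deriv by (simp add: fps_mult_nth sum_negf)
      finally have eq: "F S $ n = - (\<Sum>i=0..m. F S $ i * H S $ (m - i)) / of_nat (Suc m)"
        by (metis nonzero_mult_div_cancel_left of_nat_neq_0)
      have "H S $ k \<in> \<rat>" for k using assms(2)[of k] by (simp add: H_def)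
      then show ?thesis unfolding eq using less Suc
        by (intro Rats_divide Rats_minus_iff[THEN iffD2] Rats_sum Rats_mult) auto
    qed
  qed
  \<comment> \<open>The vanishing above \<open>card S\<close> is carried along because the new top
    coefficient also contains \<open>F S $ Suc (card S)\<close>.\<close>
  have "F S $ card S = (\<Prod>i\<in>S. - f i) \<and> (\<forall>n>card S. F S $ n = 0)" using assms(1)
  proof induction
    case empty
    then show ?case by (simp add: F_def)
  next
    case (insert i S)
    have FI: "F (insert i S) = F S - fps_const (f i) * (fps_X * F S)"
      using insert by (simp add: F_def algebra_simps)
    show ?case using insert by (auto simp: FI fps_X_mult_nth)
  qed
  then have "F S $ card S = (-1) ^ card S * (\<Prod>i\<in>S. f i)" by (simp add: prod_uminus)
  then have "(\<Prod>i\<in>S. f i) = (-1) ^ card S * F S $ card S" by simp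
  then show ?thesis using rat by (metis Rats_1 Rats_minus_iff Rats_mult Rats_power)
qed

section \<open>Arithmetic in K and integral generators\<close>

locale num_field =
  fixes K :: "complex set"
  assumes number_field: "number_field K"
begin

lemma zero_K [simp]: "0 \<in> K" and one_K [simp]: "1 \<in> K"
  and add_K: "x \<in> K \<Longrightarrow> y \<in> K \<Longrightarrow> x + y \<in> K"
  and diff_K: "x \<in> K \<Longrightarrow> y \<in> K \<Longrightarrow> x - y \<in> K"
  and mult_K: "x \<in> K \<Longrightarrow> y \<in> K \<Longrightarrow> x * y \<in> K"
  and inverse_K: "x \<in> K \<Longrightarrow> inverse x \<in> K"
proof -
  have K: "is_subfield K" using number_field by (simp add: number_field_def)
  then show "0 \<in> K" "1 \<in> K" "x \<in> K \<Longrightarrow> y \<in> K \<Longrightarrow> x + y \<in> K"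
    "x \<in> K \<Longrightarrow> y \<in> K \<Longrightarrow> x - y \<in> K" "x \<in> K \<Longrightarrow> y \<in> K \<Longrightarrow> x * y \<in> K"
    by (auto simp: is_subfield_def)
  show "x \<in> K \<Longrightarrow> inverse x \<in> K"
    using K by (cases "x = 0") (auto simp: is_subfield_def)
qed

lemma minus_K: "x \<in> K \<Longrightarrow> - x \<in> K"
  using diff_K[of 0 x] by simp

lemma divide_K: "x \<in> K \<Longrightarrow> y \<in> K \<Longrightarrow> x / y \<in> K"
  by (simp add: divide_inverse mult_K inverse_K)

lemma power_K: "x \<in> K \<Longrightarrow> x ^ k \<in> K"
  by (induction k) (auto intro: mult_K)

lemma sum_K: "(\<And>i. i \<in> I \<Longrightarrow> f i \<in> K) \<Longrightarrow> sum f I \<in> K"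
  by (induction I rule: infinite_finite_induct) (auto intro: add_K)

lemma of_nat_K [simp]: "of_nat k \<in> K"
  by (induction k) (auto intro: add_K)

lemma of_int_K [simp]: "of_int k \<in> K"
  by (cases k rule: int_cases2) (auto intro: minus_K)

lemma of_rat_K [simp]: "of_rat q \<in> K"
  by (cases q) (auto simp: Fract_of_int_quotient of_rat_divide intro: divide_K)

lemmas K_intros = add_K diff_K mult_K inverse_K minus_K divide_K power_K sum_K

lemma subspace_K: "Q.subspace K"
  by (auto simp: Q.subspace_def intro: K_intros)

lemma spanning_set:
  obtains B where "finite B" "B \<subseteq> K" "Q.span B = K"
proof -
  obtain B where B: "finite B" "B \<subseteq> K"
    "\<And>x. x \<in> K \<Longrightarrow> \<exists>q :: complex \<Rightarrow> rat. x = (\<Sum>b\<in>B. of_rat (q b) * b)"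
    using number_field unfolding number_field_def by blast
  have "x \<in> Q.span B" if x: "x \<in> K" for x
  proof -
    obtain q :: "complex \<Rightarrow> rat" where "x = (\<Sum>b\<in>B. of_rat (q b) * b)" using B(3)[OF x] by blast
    then show ?thesis by (simp add: Q.span_sum Q.span_scale Q.span_base)
  qed
  then show ?thesis using that B Q.span_minimal[OF B(2) subspace_K] by blast
qed

text \<open>Multiplication by x is given on the spanning set by rational coefficients. After
  clearing their denominators, \<open>of_nat d * x\<close> preserves the group spanned by
  \<open>B\<close>; linear independence of \<open>B\<close> is not at stake.\<close>

lemma algebraic_integer_multiple:
  assumes x: "x \<in> K"
  obtains d :: nat where "d > 0" "algebraic_integer (of_nat d * x)"
proof -
  obtain B where B: "finite B" "B \<subseteq> K" "Q.span B = K" by (rule spanning_set)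
  have "\<exists>q :: complex \<Rightarrow> rat. x * b = (\<Sum>b'\<in>B. of_rat (q b') * b')" if "b \<in> B" for b
    using that x B Q.span_finite[OF B(1)] mult_K[of x b] by blast
  then obtain q :: "complex \<Rightarrow> complex \<Rightarrow> rat"
    where q: "\<And>b. b \<in> B \<Longrightarrow> x * b = (\<Sum>b'\<in>B. of_rat (q b b') * b')" by metis
  have "finite (case_prod q ` (B \<times> B))" using B by auto
  then obtain d :: nat where d: "d > 0"
      "\<And>r. r \<in> case_prod q ` (B \<times> B) \<Longrightarrow> \<exists>k::int. of_nat d * r = of_int k"
    using common_denominator[of "case_prod q ` (B \<times> B)"] by metis
  have base: "of_nat d * x * b \<in> Z.span B" if b: "b \<in> B" for b
  proof -
    have "of_nat d * x * b = (\<Sum>b'\<in>B. of_rat (of_nat d * q b b') * b')"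
      using q[OF b] by (simp add: sum_distrib_left mult.assoc of_rat_mult)
    also have "\<dots> \<in> Z.span B"
    proof (rule Z.span_sum)
      fix b' assume b': "b' \<in> B"
      then obtain k :: int where k: "of_nat d * q b b' = of_int k" using d(2)[of "q b b'"] b by force
      show "of_rat (of_nat d * q b b') * b' \<in> Z.span B"
        unfolding k using b' by (simp add: Z.span_scale Z.span_base)
    qed
    finally show ?thesis .
  qed
  have step: "of_nat d * x * u \<in> Z.span B" if "u \<in> Z.span B" for u
    using that
  proof (induction rule: Z.span_induct_alt)
    case base then show ?case by (auto intro: Z.span_zero)
  next
    case (step c s z)
    have "of_int c * (of_nat d * x * s) + of_nat d * x * z \<in> Z.span B"
      using step base by (blast intro: Z.span_add Z.span_scale)
    then show ?case by (simp add: algebra_simps)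
  qed
  have "\<not> B \<subseteq> {0}"
  proof
    assume "B \<subseteq> {0}"
    then have "Q.span B \<subseteq> {0}" by (intro Q.span_minimal Q.subspace_single_0)
    then have "1 \<in> {0 :: complex}" using B(3) one_K by blast
    then show False by simp
  qed
  then obtain m where m: "m \<in> B" "m \<noteq> 0" by auto
  have "(of_nat d * x) ^ k * m \<in> Z.span B" for k
    using step[of "(of_nat d * x) ^ k' * m" for k'] m
    by (induction k) (auto simp: mult.assoc Z.span_base)
  then have "algebraic_integer (of_nat d * x)"
    using m B by (intro algebraic_integerI_fg[of "Z.span B" m]) (auto simp: fg_def)
  then show ?thesis using d that by blast
qed

lemma integral_basis_over_Q:
  obtains B where "finite B" "B \<subseteq> ring_of_integers K" "Q.independent B" "Q.span B = K"
proof -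
  obtain B0 where B0: "finite B0" "B0 \<subseteq> K" "Q.span B0 = K" by (rule spanning_set)
  have "\<exists>d::nat. d > 0 \<and> algebraic_integer (of_nat d * b)" if "b \<in> B0" for b
    using algebraic_integer_multiple[of b] that B0 by blast
  then obtain d :: "complex \<Rightarrow> nat"
    where d: "\<And>b. b \<in> B0 \<Longrightarrow> d b > 0 \<and> algebraic_integer (of_nat (d b) * b)" by metis
  define B1 where "B1 = (\<lambda>b. of_nat (d b) * b) ` B0"
  obtain B where B: "B \<subseteq> B1" "Q.independent B" "B1 \<subseteq> Q.span B"
    using Q.maximal_independent_subset[of B1] by blast
  have B1: "B1 \<subseteq> ring_of_integers K"
    using d B0(2) by (auto simp: B1_def ring_of_integers_def intro!: mult_K)
  have "b \<in> Q.span B" if b: "b \<in> B0" for b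
  proof -
    have "of_nat (d b) * b \<in> Q.span B" using B b by (auto simp: B1_def)
    from Q.span_scale[OF this, of "inverse (of_nat (d b))"] show ?thesis
      using d[OF b] by (simp add: of_rat_inverse flip: mult.assoc)
  qed
  then have "K \<subseteq> Q.span B" using Q.span_minimal[of B0 "Q.span B"] B0(3) by auto
  moreover have "Q.span B \<subseteq> K"
    using B(1) B1 by (intro Q.span_minimal subspace_K) (auto simp: ring_of_integers_def)
  moreover have "finite B" using B(1) B0(1) unfolding B1_def by (meson finite_imageI finite_subset)
  ultimately show ?thesis using that[of B] B B1 by auto
qed

section \<open>The embeddings: finiteness and independence\<close>

abbreviation "E \<equiv> embeddings K"

lemma emb_one: "\<sigma> \<in> E \<Longrightarrow> \<sigma> 1 = 1"
  and emb_add: "\<sigma> \<in> E \<Longrightarrow> x \<in> K \<Longrightarrow> y \<in> K \<Longrightarrow> \<sigma> (x + y) = \<sigma> x + \<sigma> y"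
  and emb_mult: "\<sigma> \<in> E \<Longrightarrow> x \<in> K \<Longrightarrow> y \<in> K \<Longrightarrow> \<sigma> (x * y) = \<sigma> x * \<sigma> y"
  and emb_outside: "\<sigma> \<in> E \<Longrightarrow> x \<notin> K \<Longrightarrow> \<sigma> x = 0"
  by (auto simp: embeddings_def)

lemma emb_zero: "\<sigma> \<in> E \<Longrightarrow> \<sigma> 0 = 0"
  using emb_add[of \<sigma> 0 0] by simp

lemma emb_minus: "\<sigma> \<in> E \<Longrightarrow> x \<in> K \<Longrightarrow> \<sigma> (- x) = - \<sigma> x"
  using emb_add[of \<sigma> x "- x"] emb_zero[of \<sigma>] minus_K[of x] by (simp add: eq_neg_iff_add_eq_0 add.commute)

lemma emb_nonzero: "\<sigma> \<in> E \<Longrightarrow> x \<in> K \<Longrightarrow> x \<noteq> 0 \<Longrightarrow> \<sigma> x \<noteq> 0"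
  using emb_mult[of \<sigma> x "inverse x"] emb_one[of \<sigma>] inverse_K[of x] by auto

lemma emb_divide: "\<sigma> \<in> E \<Longrightarrow> x \<in> K \<Longrightarrow> y \<in> K \<Longrightarrow> y \<noteq> 0 \<Longrightarrow> \<sigma> (x / y) = \<sigma> x / \<sigma> y"
  using emb_mult[of \<sigma> "x / y" y] emb_nonzero[of \<sigma> y] divide_K[of x y] by (simp add: field_simps)

lemma emb_power: "\<sigma> \<in> E \<Longrightarrow> x \<in> K \<Longrightarrow> \<sigma> (x ^ k) = \<sigma> x ^ k"
  by (induction k) (simp_all add: emb_one emb_mult power_K)

lemma emb_sum: "\<sigma> \<in> E \<Longrightarrow> (\<And>i. i \<in> I \<Longrightarrow> f i \<in> K) \<Longrightarrow> \<sigma> (sum f I) = (\<Sum>i\<in>I. \<sigma> (f i))"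
  by (induction I rule: infinite_finite_induct) (auto simp: emb_zero emb_add sum_K)

lemma emb_of_nat: "\<sigma> \<in> E \<Longrightarrow> \<sigma> (of_nat k) = of_nat k"
  by (induction k) (simp_all add: emb_zero emb_one emb_add)

lemma emb_of_int: "\<sigma> \<in> E \<Longrightarrow> \<sigma> (of_int k) = of_int k"
  by (cases k rule: int_cases2) (auto simp: emb_of_nat emb_minus)

lemma emb_of_rat: "\<sigma> \<in> E \<Longrightarrow> \<sigma> (of_rat q) = of_rat q"
  by (cases q) (auto simp: Fract_of_int_quotient of_rat_divide emb_divide emb_of_int)

lemma emb_poly:
  assumes "\<sigma> \<in> E" "x \<in> K" "\<And>i. coeff p i \<in> K \<and> \<sigma> (coeff p i) = coeff p i"
  shows "\<sigma> (poly p x) = poly p (\<sigma> x)"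
  using assms by (simp add: poly_altdef emb_sum emb_mult emb_power mult_K power_K)

lemma emb_algebraic_integer_root:
  assumes "\<sigma> \<in> E" "x \<in> K" "poly (map_poly of_int p) x = 0"
  shows "poly (map_poly of_int p) (\<sigma> x) = 0"
  using emb_poly[OF assms(1,2), of "map_poly of_int p"] assms emb_zero[of \<sigma>]
  by (simp add: coeff_map_poly emb_of_int)

lemma emb_algebraic_integer:
  assumes "\<sigma> \<in> E" "x \<in> K" "algebraic_integer x"
  shows "algebraic_integer (\<sigma> x)"
  using assms emb_algebraic_integer_root unfolding algebraic_integer_def by blast

text \<open>Provides a member of \<open>E\<close>: without one, total positivity would be vacuous
  and the trace of 1 would vanish.\<close>

lemma emb_id: "(\<lambda>x. if x \<in> K then x else 0) \<in> E"
  by (auto simp: embeddings_def intro: K_intros)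

lemma emb_eqI:
  assumes "\<sigma> \<in> E" "\<tau> \<in> E" "\<And>b. b \<in> B \<Longrightarrow> \<sigma> b = \<tau> b" "Q.span B = K"
  shows "\<sigma> = \<tau>"
proof
  fix x
  have "B \<subseteq> K" using assms(4) Q.span_superset by blast
  then have "Q.span B \<subseteq> {x \<in> K. \<sigma> x = \<tau> x}"
    using assms(1-3) by (intro Q.span_minimal)
      (auto simp: Q.subspace_def emb_zero emb_add emb_mult emb_of_rat intro: K_intros)
  then have "x \<in> K \<Longrightarrow> \<sigma> x = \<tau> x" using assms(4) by blast
  then show "\<sigma> x = \<tau> x" by (cases "x \<in> K") (simp_all add: emb_outside[OF assms(1)] emb_outside[OF assms(2)])
qed

text \<open>An embedding sends each integral generator to a root of its monic polynomial and is
  determined by these finitely many values.\<close>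

lemma finite_E [simp, intro]: "finite E"
proof -
  obtain B where B: "finite B" "B \<subseteq> ring_of_integers K" "Q.span B = K"
    by (rule integral_basis_over_Q)
  have "\<exists>p :: int poly. lead_coeff p = 1 \<and> poly (map_poly of_int p) b = 0" if "b \<in> B" for b
    using that B by (auto simp: ring_of_integers_def algebraic_integer_def)
  then obtain p :: "complex \<Rightarrow> int poly"
    where p: "\<And>b. b \<in> B \<Longrightarrow> lead_coeff (p b) = 1 \<and> poly (map_poly of_int (p b)) b = 0" by metis
  define roots where "roots = (\<lambda>b. {z. poly (map_poly of_int (p b)) z = (0::complex)})"
  have "finite (roots b)" if "b \<in> B" for b
  proof -
    have "map_poly of_int (p b) \<noteq> (0 :: complex poly)"
      using p[OF that] by (auto simp: poly_eq_iff coeff_map_poly intro!: exI[of _ "degree (p b)"])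
    then show ?thesis by (simp add: roots_def poly_roots_finite)
  qed
  then have "finite (PiE B roots)" using B by (intro finite_PiE) auto
  moreover have "(\<lambda>\<sigma>. restrict \<sigma> B) ` E \<subseteq> PiE B roots"
    using emb_algebraic_integer_root p B by (auto simp: roots_def ring_of_integers_def)
  ultimately have "finite ((\<lambda>\<sigma>. restrict \<sigma> B) ` E)" by (rule rev_finite_subset)
  moreover have "inj_on (\<lambda>\<sigma>. restrict \<sigma> B) E"
  proof (rule inj_onI)
    fix \<sigma> \<tau> assume st: "\<sigma> \<in> E" "\<tau> \<in> E" and eq: "restrict \<sigma> B = restrict \<tau> B"
    have "\<sigma> b = \<tau> b" if "b \<in> B" for b using that fun_cong[OF eq, of b] by simp
    then show "\<sigma> = \<tau>" using st B by (intro emb_eqI)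
  qed
  ultimately show ?thesis by (rule finite_imageD)
qed

text \<open>Artin's argument: the relation at \<open>a * x\<close> minus \<open>\<tau> a\<close>
  times the relation at x has no \<tau> term, and \<open>\<sigma> a \<noteq> \<tau> a\<close> lets
  the induction hypothesis kill \<open>c \<sigma>\<close>. The last coefficient is read off at x =
  1.\<close>

lemma emb_independent:
  assumes "finite S" "S \<subseteq> E" "\<And>x. x \<in> K \<Longrightarrow> (\<Sum>\<sigma>\<in>S. c \<sigma> * \<sigma> x) = 0" "\<sigma> \<in> S"
  shows "c \<sigma> = 0"
  using assms
proof (induction S arbitrary: c \<sigma>)
  case empty
  then show ?case by simp
next
  case (insert \<tau> S)
  have "c \<sigma> = 0" if \<sigma>: "\<sigma> \<in> S" for \<sigma>
  proof -
    have "\<sigma> \<noteq> \<tau>" using \<sigma> insert by auto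
    then obtain a where a: "\<sigma> a \<noteq> \<tau> a" by auto
    then have aK: "a \<in> K" using emb_outside[of \<sigma>] emb_outside[of \<tau>] \<sigma> insert.prems(1) by fastforce
    have "c \<sigma> * (\<sigma> a - \<tau> a) = 0"
    proof (rule insert.IH[where c = "\<lambda>\<sigma>. c \<sigma> * (\<sigma> a - \<tau> a)"])
      fix x assume x: "x \<in> K"
      have "(\<Sum>\<sigma>\<in>insert \<tau> S. c \<sigma> * \<sigma> (a * x)) - \<tau> a * (\<Sum>\<sigma>\<in>insert \<tau> S. c \<sigma> * \<sigma> x) = 0"
        using insert.prems(2)[OF x] insert.prems(2)[OF mult_K[OF aK x]] by simp
      also have "(\<Sum>\<sigma>\<in>insert \<tau> S. c \<sigma> * \<sigma> (a * x)) = (\<Sum>\<sigma>\<in>insert \<tau> S. c \<sigma> * (\<sigma> a * \<sigma> x))"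
        using insert.prems(1) aK x by (intro sum.cong) (auto simp: emb_mult)
      finally show "(\<Sum>\<sigma>\<in>S. c \<sigma> * (\<sigma> a - \<tau> a) * \<sigma> x) = 0"
        using insert.hyps
        by (simp add: algebra_simps sum_subtractf sum_distrib_left)
    qed (use \<sigma> insert in auto)
    then show ?thesis using a by simp
  qed
  moreover have "c \<tau> = 0"
    using insert.prems(2)[of 1] insert.hyps insert.prems(1) calculation emb_one[of \<tau>]
    by (simp add: sum.neutral)
  ultimately show ?case using insert.prems by auto
qed

end

section \<open>Rationality of trace and norm\<close>

lemma map_poly_of_rat_add:
  "map_poly of_rat (p + q) = map_poly of_rat p + (map_poly of_rat q :: 'a::field_char_0 poly)"
  by (simp add: poly_eq_iff coeff_map_poly of_rat_add)

lemma map_poly_of_rat_mult: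
  "map_poly of_rat (p * q) = map_poly of_rat p * (map_poly of_rat q :: 'a::field_char_0 poly)"
  by (simp add: poly_eq_iff coeff_map_poly coeff_mult of_rat_sum of_rat_mult)

lemma map_poly_of_rat_pderiv:
  "map_poly of_rat (pderiv p) = pderiv (map_poly of_rat p :: 'a::field_char_0 poly)"
  by (simp add: poly_eq_iff coeff_map_poly coeff_pderiv of_rat_mult of_rat_add)

lemma rsquarefree_rational_annihilator:
  fixes b :: complex
  assumes "algebraic_integer b"
  obtains p :: "rat poly" where "poly (map_poly of_rat p) b = 0"
    "rsquarefree (map_poly of_rat p :: complex poly)"
proof -
  have least: "\<exists>p :: rat poly. p \<noteq> 0 \<and> poly (map_poly of_rat p) x = 0 \<and>
      (\<forall>q. q \<noteq> 0 \<longrightarrow> poly (map_poly of_rat q) x = 0 \<longrightarrow> degree p \<le> degree q)"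
    if "p \<noteq> 0" "poly (map_poly of_rat p) x = 0" for p :: "rat poly" and x :: complex
    using that exists_least_lemma[of "\<lambda>d. \<exists>p :: rat poly. p \<noteq> 0 \<and> poly (map_poly of_rat p) x = 0 \<and> degree p = d"]
      ex_has_least_nat[of "\<lambda>p :: rat poly. p \<noteq> 0 \<and> poly (map_poly of_rat p) x = 0" p degree] by blast
  obtain P :: "int poly" where P: "lead_coeff P = 1" "poly (map_poly of_int P) b = 0"
    using assms by (auto simp: algebraic_integer_def)
  have "map_poly of_rat (map_poly of_int P :: rat poly) = (map_poly of_int P :: complex poly)"
    by (simp add: map_poly_map_poly o_def)
  moreover have "map_poly of_int P \<noteq> (0 :: rat poly)"
    using P(1) by (auto simp: poly_eq_iff coeff_map_poly intro!: exI[of _ "degree P"])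
  ultimately obtain p :: "rat poly" where p: "p \<noteq> 0" "poly (map_poly of_rat p) b = 0"
      and pmin: "\<And>q. q \<noteq> 0 \<Longrightarrow> poly (map_poly of_rat q) b = 0 \<Longrightarrow> degree p \<le> degree q"
    using least[of "map_poly of_int P" b] P(2) by auto
  have "rsquarefree (map_poly of_rat p :: complex poly)"
    unfolding rsquarefree_roots
  proof (intro allI notI)
    fix r :: complex
    assume "poly (map_poly of_rat p) r = 0 \<and> poly (pderiv (map_poly of_rat p)) r = 0"
    then have r: "poly (map_poly of_rat p) r = 0" "poly (map_poly of_rat (pderiv p)) r = 0"
      by (auto simp: map_poly_of_rat_pderiv)
    obtain m :: "rat poly" where m: "m \<noteq> 0" "poly (map_poly of_rat m) r = 0"
      and mmin: "\<And>q. q \<noteq> 0 \<Longrightarrow> poly (map_poly of_rat q) r = 0 \<Longrightarrow> degree m \<le> degree q"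
      using least[OF p(1) r(1)] by blast
    have m_dvd: "m dvd q" if "poly (map_poly of_rat q) r = 0" for q
    proof -
      have "poly (map_poly of_rat (q div m * m + q mod m)) r = 0" using that by simp
      then have "poly (map_poly of_rat (q mod m)) r = 0"
        unfolding map_poly_of_rat_add map_poly_of_rat_mult using m by simp
      then have "q mod m = 0" using mmin[of "q mod m"] degree_mod_less[OF m(1), of q] by force
      then show ?thesis by auto
    qed
    have "degree m \<noteq> 0"
    proof
      assume "degree m = 0"
      then obtain c where "m = [:c:]" by (rule degree_eq_zeroE)
      then show False using m by (simp add: map_poly_pCons)
    qed
    obtain s where s: "p = m * s" using m_dvd[OF r(1)] by auto
    have deg: "degree p = degree m + degree s" using s p(1) by (auto simp: degree_mult_eq)
    have "poly (map_poly of_rat m) b = 0 \<or> poly (map_poly of_rat s) b = 0"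
      using p(2) by (simp add: s map_poly_of_rat_mult)
    then have "degree p \<le> degree m"
      using pmin[of m] pmin[of s] m(1) p(1) s deg \<open>degree m \<noteq> 0\<close> by auto
    moreover have "pderiv p \<noteq> 0" using deg \<open>degree m \<noteq> 0\<close> by (simp add: pderiv_eq_0_iff)
    then have "degree m \<le> degree (pderiv p)" using m_dvd[OF r(2)] by (intro dvd_imp_degree_le)
    ultimately show False using deg \<open>degree m \<noteq> 0\<close> by (simp add: degree_pderiv)
  qed
  then show ?thesis using that p by blast
qed

section \<open>Polynomials acting on functionals\<close>

text \<open>\<open>poly_act b q \<phi>\<close> is the action of the polynomial \<open>q\<close> on the functional \<open>\<phi>\<close> when the
  variable acts by \<open>\<phi> \<mapsto> \<phi> \<circ> (b *)\<close>.\<close>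
definition poly_act :: "complex \<Rightarrow> complex poly \<Rightarrow> (complex \<Rightarrow> complex) \<Rightarrow> complex \<Rightarrow> complex" where
  "poly_act b q \<phi> y = (\<Sum>i\<le>degree q. coeff q i * \<phi> (b ^ i * y))"

lemma poly_act_0 [simp]: "poly_act b 0 \<phi> y = 0"
  by (simp add: poly_act_def)

lemma poly_act_pCons: "poly_act b (pCons a q) \<phi> y = a * \<phi> y + poly_act b q \<phi> (b * y)"
proof (cases "q = 0")
  case True
  then show ?thesis by (simp add: poly_act_def)
next
  case False
  then show ?thesis
    by (simp add: poly_act_def sum.atMost_Suc_shift mult.assoc mult.left_commute del: sum.atMost_Suc)
qed

lemma poly_act_add: "poly_act b (p + q) \<phi> y = poly_act b p \<phi> y + poly_act b q \<phi> y"
  by (induction p q arbitrary: y rule: poly_induct2) (simp_all add: poly_act_pCons algebra_simps)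

lemma poly_act_smult: "poly_act b (smult c q) \<phi> y = c * poly_act b q \<phi> y"
  by (induction q arbitrary: y) (simp_all add: poly_act_pCons algebra_simps)

text \<open>This is how eigenvectors arise: when the left side vanishes,
  \<open>poly_act b q \<phi>\<close> has eigenvalue r.\<close>

lemma poly_act_linear_factor:
  "poly_act b ([:- r, 1:] * q) \<phi> y = poly_act b q \<phi> (b * y) - r * poly_act b q \<phi> y"
proof -
  have "[:- r, 1:] * q = smult (- r) q + pCons 0 q" by simp
  then show ?thesis by (simp only: poly_act_add poly_act_smult poly_act_pCons) simp
qed

lemma poly_act_diff_scale:
  "poly_act b q (\<lambda>y. \<phi> y - c * \<psi> y) y = poly_act b q \<phi> y - c * poly_act b q \<psi> y"
  by (induction q arbitrary: y) (simp_all add: poly_act_pCons algebra_simps)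

section \<open>The dual of K is spanned by the embeddings\<close>

context num_field
begin

definition functional :: "(complex \<Rightarrow> complex) \<Rightarrow> bool" where
  "functional \<phi> \<longleftrightarrow> (\<forall>x\<in>K. \<forall>y\<in>K. \<phi> (x + y) = \<phi> x + \<phi> y) \<and>
     (\<forall>q. \<forall>x\<in>K. \<phi> (of_rat q * x) = of_rat q * \<phi> x)"

text \<open>\<phi> = 0 is allowed, so pieces of a decomposition may vanish without a case
  distinction.\<close>

definition eigen :: "complex \<Rightarrow> (complex \<Rightarrow> complex) \<Rightarrow> bool" where
  "eigen b \<phi> \<longleftrightarrow> (\<exists>r. \<forall>y\<in>K. \<phi> (b * y) = r * \<phi> y)"

definition emb_comb :: "(complex \<Rightarrow> complex) \<Rightarrow> bool" where
  "emb_comb \<phi> \<longleftrightarrow> (\<exists>c. \<forall>x\<in>K. \<phi> x = (\<Sum>\<sigma>\<in>E. c \<sigma> * \<sigma> x))"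

lemma functional_add: "functional \<phi> \<Longrightarrow> x \<in> K \<Longrightarrow> y \<in> K \<Longrightarrow> \<phi> (x + y) = \<phi> x + \<phi> y"
  and functional_scale: "functional \<phi> \<Longrightarrow> x \<in> K \<Longrightarrow> \<phi> (of_rat q * x) = of_rat q * \<phi> x"
  by (auto simp: functional_def)

lemma functional_0: "functional \<phi> \<Longrightarrow> \<phi> 0 = 0"
  using functional_scale[of \<phi> 0 0] by simp

lemma functional_sum:
  "functional \<phi> \<Longrightarrow> (\<And>i. i \<in> I \<Longrightarrow> f i \<in> K) \<Longrightarrow> \<phi> (sum f I) = (\<Sum>i\<in>I. \<phi> (f i))"
  by (induction I rule: infinite_finite_induct) (auto simp: functional_0 functional_add sum_K)

lemma functional_poly_act:
  assumes "functional \<phi>" "b \<in> K"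
  shows "functional (poly_act b q \<phi>)"
proof (induction q)
  case 0
  then show ?case by (simp add: functional_def)
next
  case (pCons a q)
  show ?case unfolding functional_def
  proof (intro conjI ballI allI)
    fix x y assume "x \<in> K" "y \<in> K"
    then show "poly_act b (pCons a q) \<phi> (x + y) = poly_act b (pCons a q) \<phi> x + poly_act b (pCons a q) \<phi> y"
      using functional_add[OF assms(1), of x y] functional_add[OF pCons.IH, of "b * x" "b * y"] assms(2)
      by (simp add: poly_act_pCons distrib_left mult_K)
  next
    fix r x assume "x \<in> K"
    then show "poly_act b (pCons a q) \<phi> (of_rat r * x) = of_rat r * poly_act b (pCons a q) \<phi> x"
      using functional_scale[OF assms(1), of x r] functional_scale[OF pCons.IH, of "b * x" r] assms(2)
      by (simp add: poly_act_pCons distrib_left mult_K mult.left_commute[of b] mult.left_commute[of a])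
  qed
qed

lemma functional_diff_scale:
  "functional \<phi> \<Longrightarrow> functional \<psi> \<Longrightarrow> functional (\<lambda>y. \<phi> y - c * \<psi> y)"
  by (simp add: functional_def algebra_simps)

text \<open>Multiplications commute, so splitting \<phi> along b does not destroy the eigenvector
  property already reached for a.\<close>

lemma poly_act_eigenvalue:
  assumes "\<And>y. y \<in> K \<Longrightarrow> \<phi> (a * y) = r * \<phi> y" "b \<in> K" "y \<in> K"
  shows "poly_act b q \<phi> (a * y) = r * poly_act b q \<phi> y"
  using assms(3)
proof (induction q arbitrary: y)
  case (pCons c q)
  then have "poly_act b q \<phi> (a * (b * y)) = r * poly_act b q \<phi> (b * y)" using assms(2) mult_K by blast
  then show ?case using pCons.prems assms(1)
    by (simp add: poly_act_pCons mult.left_commute[of b a] distrib_left)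
qed simp

lemma poly_act_eigen:
  assumes "\<And>y. y \<in> K \<Longrightarrow> \<phi> (b * y) = r * \<phi> y" "b \<in> K" "y \<in> K"
  shows "poly_act b q \<phi> y = poly q r * \<phi> y"
  using assms(3)
proof (induction q arbitrary: y)
  case (pCons a q)
  then have "poly_act b q \<phi> (b * y) = poly q r * \<phi> (b * y)" using assms(2) mult_K by blast
  then show ?case using pCons.prems assms(1) by (simp add: poly_act_pCons distrib_right)
qed simp

text \<open>\<phi> is only rationally linear, but rational coefficients may be moved inside it,
  where they assemble to multiplication by \<open>p(b) = 0\<close>.\<close>

lemma poly_act_annihilator:
  assumes "functional \<phi>" "b \<in> K" "y \<in> K" "poly (map_poly of_rat p) b = 0"
  shows "poly_act b (map_poly of_rat p) \<phi> y = 0"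
proof -
  have "poly_act b (map_poly of_rat p) \<phi> y = (\<Sum>i\<le>degree p. \<phi> (of_rat (coeff p i) * (b ^ i * y)))"
    using assms by (simp add: poly_act_def degree_map_poly coeff_map_poly functional_scale mult_K power_K)
  also have "\<dots> = \<phi> (\<Sum>i\<le>degree p. of_rat (coeff p i) * (b ^ i * y))"
    using assms by (subst functional_sum[OF assms(1)]) (auto intro!: mult_K power_K)
  also have "(\<Sum>i\<le>degree p. of_rat (coeff p i) * (b ^ i * y)) = poly (map_poly of_rat p) b * y"
    by (simp add: poly_altdef degree_map_poly coeff_map_poly sum_distrib_right mult.assoc)
  finally show ?thesis using assms functional_0 by simp
qed

lemma emb_comb_add_scale:
  assumes "emb_comb \<phi>" "emb_comb \<psi>" "\<And>x. x \<in> K \<Longrightarrow> \<chi> x = \<phi> x + c * \<psi> x"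
  shows "emb_comb \<chi>"
proof -
  obtain a b where "\<And>x. x \<in> K \<Longrightarrow> \<phi> x = (\<Sum>\<sigma>\<in>E. a \<sigma> * \<sigma> x)" "\<And>x. x \<in> K \<Longrightarrow> \<psi> x = (\<Sum>\<sigma>\<in>E. b \<sigma> * \<sigma> x)"
    using assms by (auto simp: emb_comb_def)
  then show ?thesis unfolding emb_comb_def using assms(3)
    by (intro exI[of _ "\<lambda>\<sigma>. a \<sigma> + c * b \<sigma>"])
       (simp add: sum.distrib sum_distrib_left algebra_simps)
qed

lemma emb_comb_zero: "(\<And>x. x \<in> K \<Longrightarrow> \<phi> x = 0) \<Longrightarrow> emb_comb \<phi>"
  unfolding emb_comb_def by (intro exI[of _ "\<lambda>_. 0"]) simp

text \<open>The elements acting by a scalar form a rational subspace, hence all of K. Comparing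
  scalars gives \<open>\<phi> (x * y) * \<phi> 1 = \<phi> x * \<phi> y\<close>: either
  \<open>\<phi> 1 = 0\<close> and \<phi> vanishes on K, or \<phi> divided by \<open>\<phi> 1\<close>
  is an embedding.\<close>

lemma emb_comb_if_joint_eigen:
  assumes \<phi>: "functional \<phi>" and B: "Q.span B = K" and ev: "\<And>b. b \<in> B \<Longrightarrow> eigen b \<phi>"
  shows "emb_comb \<phi>"
proof -
  have BK: "B \<subseteq> K" using B Q.span_superset by blast
  have "Q.span B \<subseteq> {x \<in> K. eigen x \<phi>}"
  proof (rule Q.span_minimal)
    show "B \<subseteq> {x \<in> K. eigen x \<phi>}" using BK ev by auto
    show "Q.subspace {x \<in> K. eigen x \<phi>}"
    proof (rule Q.subspaceI)
      show "0 \<in> {x \<in> K. eigen x \<phi>}" using \<phi> by (auto simp: eigen_def functional_0 intro: exI[of _ 0])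
    next
      fix x y assume xy: "x \<in> {x \<in> K. eigen x \<phi>}" "y \<in> {x \<in> K. eigen x \<phi>}"
      then obtain r s where "\<forall>z\<in>K. \<phi> (x * z) = r * \<phi> z" "\<forall>z\<in>K. \<phi> (y * z) = s * \<phi> z"
        by (auto simp: eigen_def)
      then have "\<forall>z\<in>K. \<phi> ((x + y) * z) = (r + s) * \<phi> z"
        using xy \<phi> by (simp add: distrib_right functional_add mult_K)
      then show "x + y \<in> {x \<in> K. eigen x \<phi>}" using xy by (auto simp: eigen_def add_K)
    next
      fix q x assume x: "x \<in> {x \<in> K. eigen x \<phi>}"
      then obtain r where "\<forall>z\<in>K. \<phi> (x * z) = r * \<phi> z" by (auto simp: eigen_def)
      then have "\<forall>z\<in>K. \<phi> (of_rat q * x * z) = (of_rat q * r) * \<phi> z"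
        using x \<phi> by (simp add: mult.assoc functional_scale mult_K)
      then show "of_rat q * x \<in> {x \<in> K. eigen x \<phi>}" using x unfolding eigen_def by (auto intro: mult_K)
    qed
  qed
  then have ev': "\<exists>r. \<forall>y\<in>K. \<phi> (x * y) = r * \<phi> y" if "x \<in> K" for x
    using that B by (auto simp: eigen_def)
  show ?thesis
  proof (cases "\<phi> 1 = 0")
    case True
    have "\<phi> x = 0" if x: "x \<in> K" for x
    proof -
      obtain r where "\<forall>y\<in>K. \<phi> (x * y) = r * \<phi> y" using ev'[OF x] by blast
      then show ?thesis using True one_K by fastforce
    qed
    then show ?thesis by (rule emb_comb_zero)
  next
    case False
    define \<chi> where "\<chi> = (\<lambda>x. if x \<in> K then \<phi> x / \<phi> 1 else 0)"
    have mult: "\<phi> (x * y) * \<phi> 1 = \<phi> x * \<phi> y" if xy: "x \<in> K" "y \<in> K" for x y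
    proof -
      obtain r where r: "\<forall>y\<in>K. \<phi> (x * y) = r * \<phi> y" using ev'[OF xy(1)] by blast
      have "\<phi> x = r * \<phi> 1" using bspec[OF r one_K] by simp
      then show ?thesis using r xy by simp
    qed
    have "\<chi> \<in> E"
      unfolding embeddings_def mem_Collect_eq
    proof (intro conjI ballI allI impI)
      fix x y assume xy: "x \<in> K" "y \<in> K"
      then show "\<chi> (x + y) = \<chi> x + \<chi> y"
        using \<phi> by (simp add: \<chi>_def add_K functional_add add_divide_distrib)
      have "\<phi> (x * y) / \<phi> 1 = (\<phi> x / \<phi> 1) * (\<phi> y / \<phi> 1)"
        using mult[OF xy] False by (simp add: eq_divide_eq)
      then show "\<chi> (x * y) = \<chi> x * \<chi> y" using xy by (simp add: \<chi>_def mult_K)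
    qed (use False in \<open>simp_all add: \<chi>_def\<close>)
    have "\<phi> x = (\<Sum>\<sigma>\<in>E. (if \<sigma> = \<chi> then \<phi> 1 else 0) * \<sigma> x)" if x: "x \<in> K" for x
    proof -
      have "(\<Sum>\<sigma>\<in>E. (if \<sigma> = \<chi> then \<phi> 1 else 0) * \<sigma> x) = (\<Sum>\<sigma>\<in>E. if \<sigma> = \<chi> then \<phi> 1 * \<sigma> x else 0)"
        by (intro sum.cong) auto
      also have "\<dots> = \<phi> 1 * \<chi> x" using \<open>\<chi> \<in> E\<close> by simp
      also have "\<dots> = \<phi> x" using x False by (simp add: \<chi>_def)
      finally show ?thesis ..
    qed
    then show ?thesis unfolding emb_comb_def
      by (intro exI[of _ "\<lambda>\<sigma>. if \<sigma> = \<chi> then \<phi> 1 else 0"] ballI)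
  qed
qed

text \<open>Simultaneous diagonalisation. The outer induction runs over the set \<open>T\<close> of
  generators for which \<phi> is not yet an eigenvector; each of them acts diagonalisably because it
  has an annihilator with simple roots.\<close>

lemma functional_emb_comb:
  assumes "functional \<phi>"
  shows "emb_comb \<phi>"
proof -
  obtain B where B: "finite B" "B \<subseteq> ring_of_integers K" "Q.span B = K" by (rule integral_basis_over_Q)
  have BK: "B \<subseteq> K" using B by (auto simp: ring_of_integers_def)
  have "emb_comb \<phi>" if "finite T" "T \<subseteq> B" "functional \<phi>" "\<And>b. b \<in> B - T \<Longrightarrow> eigen b \<phi>" for T \<phi>
    using that
  proof (induction T arbitrary: \<phi>)
    case empty
    then show ?case using emb_comb_if_joint_eigen[OF _ B(3)] by auto
  next
    case (insert b T)
    note outer_IH = insert.IH and outer_prems = insert.prems and outer_hyps = insert.hyps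
    have b: "b \<in> K" "algebraic_integer b" using insert.prems B by (auto simp: ring_of_integers_def)
    \<comment> \<open>Induction on the roots \<open>R\<close> of a split annihilator of b: each
      round separates the component of one root and leaves a functional killed by the remaining
      factors.\<close>
    have split: "emb_comb \<phi>"
      if "finite R" "functional \<phi>" "\<And>a. a \<in> B - insert b T \<Longrightarrow> eigen a \<phi>"
        "\<And>y. y \<in> K \<Longrightarrow> poly_act b (\<Prod>r\<in>R. [:- r, 1:]) \<phi> y = 0" for R \<phi>
      using that
    proof (induction R arbitrary: \<phi>)
      case empty
      then have "\<phi> y = 0" if "y \<in> K" for y using that by (simp add: one_pCons poly_act_pCons)
      then show ?case by (rule emb_comb_zero)
    next
      case (insert r R)
      define q where "q = (\<Prod>r\<in>R. [:- r, 1:])"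
      define \<psi> where "\<psi> = poly_act b q \<phi>"
      have \<psi>_eigen: "\<psi> (b * y) = r * \<psi> y" if "y \<in> K" for y
        using insert.prems(3)[OF that] insert.hyps
        by (simp add: \<psi>_def q_def poly_act_linear_factor del: mult_pCons_left)
      have \<psi>_fun: "functional \<psi>" unfolding \<psi>_def using insert.prems b by (intro functional_poly_act)
      have \<psi>_ev: "eigen a \<psi>" if "a \<in> B - insert b T" for a
        using insert.prems(2)[OF that] b unfolding eigen_def \<psi>_def by (metis poly_act_eigenvalue)
      have "emb_comb \<psi>"
      proof (rule outer_IH)
        show "eigen a \<psi>" if "a \<in> B - T" for a
          using \<psi>_eigen \<psi>_ev[of a] that by (cases "a = b") (auto simp: eigen_def)
      qed (use outer_prems \<psi>_fun in auto)
      \<comment> \<open>\<open>q\<close> acts on the r-eigenvector \<psi> as the scalar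
        \<open>k\<close>, nonzero since r is not in \<open>R\<close>. So
        \<open>\<phi> - \<psi> / k\<close> is killed by \<open>q\<close>, while \<psi> falls under
        the outer induction.\<close>
      define k where "k = poly q r"
      have "k \<noteq> 0" using insert.hyps by (auto simp: k_def q_def poly_prod)
      have "emb_comb (\<lambda>y. \<phi> y - 1 / k * \<psi> y)"
      proof (rule insert.IH)
        show "functional (\<lambda>y. \<phi> y - 1 / k * \<psi> y)"
          using insert.prems(1) \<psi>_fun by (rule functional_diff_scale)
        show "eigen a (\<lambda>y. \<phi> y - 1 / k * \<psi> y)" if a: "a \<in> B - insert b T" for a
        proof -
          obtain s where s: "\<And>y. y \<in> K \<Longrightarrow> \<phi> (a * y) = s * \<phi> y"
            using insert.prems(2)[OF a] by (auto simp: eigen_def)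
          have "\<psi> (a * y) = s * \<psi> y" if "y \<in> K" for y
            unfolding \<psi>_def using that a BK b s by (intro poly_act_eigenvalue) auto
          with s show ?thesis by (auto simp: eigen_def algebra_simps intro!: exI[of _ s])
        qed
        show "poly_act b (\<Prod>r\<in>R. [:- r, 1:]) (\<lambda>y. \<phi> y - 1 / k * \<psi> y) y = 0" if "y \<in> K" for y
        proof -
          have "poly_act b q \<psi> y = k * \<psi> y"
            unfolding k_def using \<psi>_eigen b(1) that by (rule poly_act_eigen)
          then show ?thesis using \<open>k \<noteq> 0\<close>
            unfolding q_def[symmetric] poly_act_diff_scale \<psi>_def[symmetric] by simp
        qed
      qed
      then show ?case using \<open>emb_comb \<psi>\<close> by (rule emb_comb_add_scale[where c = "1 / k"]) simp
    qed
    obtain p :: "rat poly" where p: "poly (map_poly of_rat p) b = 0"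
        "rsquarefree (map_poly of_rat p :: complex poly)"
      using rsquarefree_rational_annihilator[OF b(2)] by blast
    define P :: "complex poly" where "P = map_poly of_rat p"
    have "P \<noteq> 0" using p(2) by (auto simp: P_def rsquarefree_def)
    have P: "smult (lead_coeff P) (\<Prod>z | poly P z = 0. [:- z, 1:]) = P"
      using complex_poly_decompose_rsquarefree p(2) by (simp add: P_def)
    have "poly_act b (\<Prod>z | poly P z = 0. [:- z, 1:]) \<phi> y = 0" if "y \<in> K" for y
    proof -
      have "lead_coeff P * poly_act b (\<Prod>z | poly P z = 0. [:- z, 1:]) \<phi> y = poly_act b P \<phi> y"
        by (subst (3) P[symmetric]) (simp only: poly_act_smult)
      also have "\<dots> = 0"
        unfolding P_def using outer_prems(2) b(1) that p(1) by (rule poly_act_annihilator)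
      finally show ?thesis using \<open>P \<noteq> 0\<close> by simp
    qed
    then show ?case using outer_prems \<open>P \<noteq> 0\<close> by (intro split[of "{z. poly P z = 0}"]) (auto simp: poly_roots_finite)
  qed
  from this[of B] show ?thesis using assms B(1) by auto
qed

section \<open>Integrality of trace and norm\<close>

text \<open>The coordinates with respect to a basis are functionals, hence combinations of
  embeddings with coefficients \<open>c b \<sigma>\<close>. This turns the sum of the
  \<open>\<sigma> x\<close> into the sum of the diagonal coordinates \<open>co b (x * b)\<close>,
  which are rational by definition.\<close>

lemma trace_Rats:
  assumes x: "x \<in> K"
  shows "nf_trace K x \<in> \<rat>"
proof -
  obtain B where B: "finite B" "B \<subseteq> ring_of_integers K" "Q.independent B" "Q.span B = K"
    by (rule integral_basis_over_Q)
  have BK: "B \<subseteq> K" using B by (auto simp: ring_of_integers_def)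
  define co where "co = (\<lambda>b y. of_rat (Q.representation B y b) :: complex)"
  have sum_co: "(\<Sum>b\<in>B. co b y * b) = y" if "y \<in> K" for y
    using Q.sum_representation_eq[OF B(3) _ B(1), of y] that B(4) by (simp add: co_def)
  have "functional (co b)" for b
    using B by (simp add: functional_def co_def Q.representation_add Q.representation_scale of_rat_add of_rat_mult)
  then have "\<exists>c. \<forall>y\<in>K. co b y = (\<Sum>\<sigma>\<in>E. c \<sigma> * \<sigma> y)" for b
    using functional_emb_comb by (simp add: emb_comb_def)
  then obtain c where c: "\<And>b y. y \<in> K \<Longrightarrow> co b y = (\<Sum>\<sigma>\<in>E. c b \<sigma> * \<sigma> y)" by metis
  \<comment> \<open>Product of the coefficient matrix \<open>c b \<sigma>\<close> with the matrix of
    values \<open>\<tau> b\<close>. Expanding \<open>\<tau> y\<close> in the basis and using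
    independence identifies it as the identity matrix; only its diagonal is needed.\<close>
  define d where "d = (\<lambda>\<sigma> \<tau>. \<Sum>b\<in>B. c b \<sigma> * \<tau> b)"
  have "d \<tau> \<tau> = 1" if \<tau>: "\<tau> \<in> E" for \<tau>
  proof -
    have "d \<tau> \<tau> - (if \<tau> = \<tau> then 1 else 0) = 0"
    proof (rule emb_independent[OF finite_E order_refl _ \<tau>, where c = "\<lambda>\<sigma>. d \<sigma> \<tau> - (if \<sigma> = \<tau> then 1 else 0)"])
      fix y assume y: "y \<in> K"
      have "\<tau> y = \<tau> (\<Sum>b\<in>B. co b y * b)" using sum_co[OF y] by simp
      also have "\<dots> = (\<Sum>b\<in>B. co b y * \<tau> b)"
        using \<tau> BK by (subst emb_sum) (auto simp: co_def emb_mult emb_of_rat intro!: mult_K sum.cong)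
      also have "\<dots> = (\<Sum>b\<in>B. \<Sum>\<sigma>\<in>E. c b \<sigma> * \<tau> b * \<sigma> y)"
        using y by (simp add: c sum_distrib_left sum_distrib_right mult_ac)
      also have "\<dots> = (\<Sum>\<sigma>\<in>E. d \<sigma> \<tau> * \<sigma> y)"
        by (subst sum.swap) (simp add: d_def sum_distrib_right)
      finally show "(\<Sum>\<sigma>\<in>E. (d \<sigma> \<tau> - (if \<sigma> = \<tau> then 1 else 0)) * \<sigma> y) = 0"
        using \<tau> by (simp add: left_diff_distrib sum_subtractf if_distrib[of "\<lambda>c. c * _"] cong: if_cong)
    qed
    then show ?thesis by simp
  qed
  then have "nf_trace K x = (\<Sum>\<sigma>\<in>E. \<sigma> x * d \<sigma> \<sigma>)" by (simp add: nf_trace_def)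
  also have "\<dots> = (\<Sum>b\<in>B. \<Sum>\<sigma>\<in>E. c b \<sigma> * (\<sigma> x * \<sigma> b))"
    by (subst sum.swap) (simp add: d_def sum_distrib_left mult_ac)
  also have "\<dots> = (\<Sum>b\<in>B. co b (x * b))"
    using x BK by (intro sum.cong refl) (auto simp: c mult_K emb_mult subset_iff)
  also have "\<dots> \<in> \<rat>" by (auto simp: co_def intro: Rats_sum)
  finally show ?thesis .
qed

text \<open>The power sums of the conjugates of x are the traces of its powers.\<close>

lemma norm_Rats:
  assumes "x \<in> K"
  shows "(\<Prod>\<sigma>\<in>E. \<sigma> x) \<in> \<rat>"
proof (rule prod_Rats_if_power_sums_Rats)
  show "(\<Sum>\<sigma>\<in>E. \<sigma> x ^ Suc k) \<in> \<rat>" for k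
    using trace_Rats[of "x ^ Suc k"] assms power_K[of x "Suc k"] emb_power[of _ x "Suc k"]
    by (simp add: nf_trace_def)
qed auto

lemma trace_Ints:
  assumes "x \<in> ring_of_integers K"
  shows "nf_trace K x \<in> \<int>"
proof (rule rational_algebraic_int_is_int)
  show "nf_trace K x \<in> \<rat>" using assms trace_Rats by (simp add: ring_of_integers_def)
  have "algebraic_integer (nf_trace K x)" unfolding nf_trace_def
    using assms by (auto simp: ring_of_integers_def intro!: algebraic_integer_sum dest: emb_algebraic_integer)
  then show "algebraic_int (nf_trace K x)" by (simp add: algebraic_integer_iff)
qed

lemma norm_Ints:
  assumes "x \<in> ring_of_integers K"
  shows "(\<Prod>\<sigma>\<in>E. \<sigma> x) \<in> \<int>"
proof (rule rational_algebraic_int_is_int)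
  show "(\<Prod>\<sigma>\<in>E. \<sigma> x) \<in> \<rat>" using assms norm_Rats by (simp add: ring_of_integers_def)
  have "algebraic_integer (\<Prod>\<sigma>\<in>E. \<sigma> x)"
    using assms by (auto simp: ring_of_integers_def intro!: algebraic_integer_prod dest: emb_algebraic_integer)
  then show "algebraic_int (\<Prod>\<sigma>\<in>E. \<sigma> x)" by (simp add: algebraic_integer_iff)
qed

lemma norm_unit:
  assumes "x \<in> nf_units K"
  shows "nf_norm K x = 1 \<or> nf_norm K x = - 1"
proof -
  have x: "x \<in> ring_of_integers K" "inverse x \<in> ring_of_integers K" "x \<noteq> 0" "x \<in> K" "inverse x \<in> K"
    using assms by (auto simp: nf_units_def ring_of_integers_def)
  obtain k l where kl: "(\<Prod>\<sigma>\<in>E. \<sigma> x) = of_int k" "(\<Prod>\<sigma>\<in>E. \<sigma> (inverse x)) = of_int l"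
    using norm_Ints[OF x(1)] norm_Ints[OF x(2)] by (auto elim!: Ints_cases)
  have "\<sigma> x * \<sigma> (inverse x) = 1" if "\<sigma> \<in> E" for \<sigma>
    using emb_mult[OF that x(4,5)] emb_one[OF that] x(3) by simp
  then have "(\<Prod>\<sigma>\<in>E. \<sigma> x) * (\<Prod>\<sigma>\<in>E. \<sigma> (inverse x)) = 1"
    by (simp flip: prod.distrib)
  then have "of_int (k * l) = (of_int 1 :: complex)" by (simp add: kl)
  then have "k * l = 1" unfolding of_int_eq_iff .
  then show ?thesis by (auto simp: nf_norm_def kl zmult_eq_1_iff)
qed

end

section \<open>Invertibility of fractional ideals\<close>

context num_field
begin

abbreviation "\<O> \<equiv> ring_of_integers K"

lemma O_K: "x \<in> \<O> \<Longrightarrow> x \<in> K"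
  and zero_O [simp]: "0 \<in> \<O>"
  and one_O [simp]: "1 \<in> \<O>"
  and of_int_O [simp]: "of_int k \<in> \<O>"
  and add_O: "x \<in> \<O> \<Longrightarrow> y \<in> \<O> \<Longrightarrow> x + y \<in> \<O>"
  and mult_O: "x \<in> \<O> \<Longrightarrow> y \<in> \<O> \<Longrightarrow> x * y \<in> \<O>"
  and minus_O: "x \<in> \<O> \<Longrightarrow> - x \<in> \<O>"
  by (auto simp: ring_of_integers_def algebraic_integer_add algebraic_integer_mult
      algebraic_integer_minus intro: K_intros)

lemma of_nat_O [simp]: "of_nat k \<in> \<O>"
  using of_int_O[of "int k"] by simp

lemma diff_O: "x \<in> \<O> \<Longrightarrow> y \<in> \<O> \<Longrightarrow> x - y \<in> \<O>"
  using add_O[of x "- y"] minus_O[of y] by simp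

lemma sum_O: "(\<And>i. i \<in> I \<Longrightarrow> f i \<in> \<O>) \<Longrightarrow> sum f I \<in> \<O>"
  by (induction I rule: infinite_finite_induct) (auto intro: add_O)

section \<open>The trace form and the codifferent\<close>

lemma trace_add: "x \<in> K \<Longrightarrow> y \<in> K \<Longrightarrow> nf_trace K (x + y) = nf_trace K x + nf_trace K y"
  by (simp add: nf_trace_def emb_add sum.distrib)

lemma trace_scale: "x \<in> K \<Longrightarrow> nf_trace K (of_rat q * x) = of_rat q * nf_trace K x"
  by (simp add: nf_trace_def emb_mult emb_of_rat sum_distrib_left)

text \<open>If x were nonzero, pairing it with its inverse would give the trace of 1, the number of
  embeddings.\<close>

lemma trace_nondegenerate:
  assumes x: "x \<in> K" and B: "Q.span B = K" and zero: "\<And>b. b \<in> B \<Longrightarrow> nf_trace K (x * b) = 0"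
  shows "x = 0"
proof (rule ccontr)
  assume "x \<noteq> 0"
  have BK: "B \<subseteq> K" using B Q.span_superset by blast
  have "Q.span B \<subseteq> {y \<in> K. nf_trace K (x * y) = 0}"
  proof (rule Q.span_minimal)
    show "B \<subseteq> {y \<in> K. nf_trace K (x * y) = 0}" using BK zero by auto
    have "nf_trace K 0 = 0" using trace_scale[of 0 0] by simp
    then show "Q.subspace {y \<in> K. nf_trace K (x * y) = 0}"
      using x by (auto simp: Q.subspace_def distrib_left trace_add mult_K add_K
          mult.left_commute[of x] trace_scale)
  qed
  then have "nf_trace K (x * inverse x) = 0" using B x inverse_K by blast
  moreover have "nf_trace K 1 = of_nat (card E)" by (simp add: nf_trace_def emb_one)
  moreover have "card E \<noteq> 0" using emb_id by auto
  ultimately show False using \<open>x \<noteq> 0\<close> by simp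
qed

definition codifferent :: "complex set" where
  "codifferent = {x \<in> K. \<forall>y\<in>\<O>. nf_trace K (x * y) \<in> \<int>}"

lemma O_subset_codifferent: "\<O> \<subseteq> codifferent"
  using trace_Ints mult_O O_K by (auto simp: codifferent_def)

lemma codifferent_mult: "r \<in> \<O> \<Longrightarrow> x \<in> codifferent \<Longrightarrow> r * x \<in> codifferent"
  unfolding codifferent_def using mult_O O_K mult_K by (auto simp: mult.assoc mult.left_commute[of r])

lemma codifferent_add: "x \<in> codifferent \<Longrightarrow> y \<in> codifferent \<Longrightarrow> x + y \<in> codifferent"
  using O_K by (auto simp: codifferent_def add_K distrib_right trace_add mult_K)

text \<open>The maps \<open>x \<mapsto> Tr (x b)\<close> for integral generators b are
  integer-valued here and separate points by nondegeneracy. The floor of the real part in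
  \<open>f\<close> merely transports these integers to type \<open>int\<close>.\<close>

lemma fg_codifferent: "fg codifferent"
proof -
  obtain B where B: "finite B" "B \<subseteq> \<O>" "Q.span B = K"
    by (rule integral_basis_over_Q)
  define f where "f = (\<lambda>b x. \<lfloor>Re (nf_trace K (x * b))\<rfloor>)"
  have f: "of_int (f b x) = nf_trace K (x * b)" if "b \<in> B" "x \<in> codifferent" for b x
  proof -
    have "nf_trace K (x * b) \<in> \<int>" using that B(2) by (auto simp: codifferent_def)
    then show ?thesis by (auto simp: f_def elim!: Ints_cases)
  qed
  have K: "x \<in> K" if "x \<in> codifferent" for x using that by (simp add: codifferent_def)
  show ?thesis
  proof (rule fg_if_separated)
    show "finite (f ` B)" using B by simp
    show "Z.subspace codifferent"
      using codifferent_add codifferent_mult O_subset_codifferent zero_O by (auto simp: Z.subspace_def)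
    fix g x y assume g: "g \<in> f ` B" and xy: "x \<in> codifferent" "y \<in> codifferent"
    then obtain b where b: "g = f b" "b \<in> B" by auto
    have "(of_int (f b (x + y)) :: complex) = of_int (f b x + f b y)"
      using xy b B(2) by (simp add: f codifferent_add distrib_right trace_add K O_K mult_K subset_iff)
    then show "g (x + y) = g x + g y" unfolding b of_int_eq_iff .
  next
    fix x assume x: "x \<in> codifferent" "\<forall>g\<in>f ` B. g x = 0"
    then have "nf_trace K (x * b) = 0" if "b \<in> B" for b using f[OF that x(1)] that by simp
    then show "x = 0" using trace_nondegenerate[OF K[OF x(1)] B(3)] by blast
  qed
qed

lemma subspace_O: "Z.subspace \<O>"
  by (auto simp: Z.subspace_def intro: add_O mult_O)

text \<open>Integrality of traces puts \<O> inside the codifferent, from which it inherits finite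
  generation.\<close>

lemma fg_O: "fg \<O>"
  using fg_subgroup[OF fg_codifferent subspace_O O_subset_codifferent] .

text \<open>Bounded denominators of all powers suffice for integrality, since the multiples
  \<open>d * m * y ^ k\<close> stay in the finitely generated \<O>. This handles elements
  stabilising a fractional ideal.\<close>

lemma integrally_closed:
  assumes "m \<noteq> 0" "d \<noteq> 0" "y \<in> K" "\<And>k. d * (y ^ k * m) \<in> \<O>"
  shows "y \<in> \<O>"
proof -
  have "algebraic_integer y"
    using assms(1,2,4) by (intro algebraic_integerI_fg[OF fg_O, of "d * m"]) (auto simp: algebra_simps)
  then show ?thesis using assms(3) by (simp add: ring_of_integers_def)
qed

lemma fg_bounded:
  assumes "fg M" "M \<subseteq> K"
  obtains d :: nat where "d > 0" "\<And>x. x \<in> M \<Longrightarrow> of_nat d * x \<in> \<O>"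
proof -
  obtain S where S: "finite S" "M = Z.span S" using assms by (auto simp: fg_def)
  have SK: "S \<subseteq> K" using S assms(2) Z.span_superset by blast
  have "\<exists>d::nat. d > 0 \<and> of_nat d * s \<in> \<O>" if "s \<in> S" for s
    using algebraic_integer_multiple[of s] that SK unfolding ring_of_integers_def
    by (metis (mono_tags, lifting) mem_Collect_eq mult_K of_nat_K subset_iff)
  then obtain d :: "complex \<Rightarrow> nat" where d: "\<And>s. s \<in> S \<Longrightarrow> d s > 0 \<and> of_nat (d s) * s \<in> \<O>" by metis
  define D where "D = (\<Prod>s\<in>S. d s)"
  have "D > 0" using d S by (auto simp: D_def intro: prod_pos)
  have base: "of_nat D * s \<in> \<O>" if "s \<in> S" for s
  proof -
    have "of_nat D * s = of_nat (\<Prod>s\<in>S - {s}. d s) * (of_nat (d s) * s)"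
      using S that by (simp add: D_def prod.remove[of S s] algebra_simps)
    also have "\<dots> \<in> \<O>" by (rule mult_O[OF of_nat_O]) (use d[OF that] in blast)
    finally show ?thesis .
  qed
  have "of_nat D * x \<in> \<O>" if "x \<in> Z.span S" for x
    using that
  proof (induction rule: Z.span_induct_alt)
    case base then show ?case by simp
  next
    case (step c s z)
    then have "of_int c * (of_nat D * s) + of_nat D * z \<in> \<O>" using base by (intro add_O mult_O[OF of_int_O]) auto
    then show ?case by (simp add: algebra_simps)
  qed
  then show ?thesis using that \<open>D > 0\<close> S by blast
qed

section \<open>Sums, products and inverses of fractional ideals\<close>

abbreviation "ideal_inv \<equiv> fideal_inv K"

lemma frac_idealD:
  assumes "frac_ideal K I"
  shows "x \<in> I \<Longrightarrow> x \<in> K" "0 \<in> I" "\<exists>x\<in>I. x \<noteq> 0" "x \<in> I \<Longrightarrow> y \<in> I \<Longrightarrow> x + y \<in> I"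
    "r \<in> \<O> \<Longrightarrow> x \<in> I \<Longrightarrow> r * x \<in> I" "\<exists>d\<in>\<O>. d \<noteq> 0 \<and> (\<forall>x\<in>I. d * x \<in> \<O>)"
  using assms unfolding frac_ideal_def by blast+

lemma frac_ideal_minus: "frac_ideal K I \<Longrightarrow> x \<in> I \<Longrightarrow> - x \<in> I"
  using frac_idealD(5)[of I "- 1" x] minus_O[OF one_O] by simp

lemma frac_ideal_diff: "frac_ideal K I \<Longrightarrow> x \<in> I \<Longrightarrow> y \<in> I \<Longrightarrow> x - y \<in> I"
  using frac_idealD(4)[of I x "- y"] frac_ideal_minus[of I y] by simp

lemma frac_ideal_codifferent: "frac_ideal K codifferent"
proof -
  obtain d :: nat where d: "d > 0" "\<And>x. x \<in> codifferent \<Longrightarrow> of_nat d * x \<in> \<O>"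
    using fg_bounded[OF fg_codifferent] by (auto simp: codifferent_def)
  have "(\<exists>d\<in>\<O>. d \<noteq> 0 \<and> (\<forall>x\<in>codifferent. d * x \<in> \<O>))"
    using d by (intro bexI[of _ "of_nat d"]) auto
  moreover have "1 \<in> codifferent" "0 \<in> codifferent"
    using O_subset_codifferent one_O zero_O by blast+
  moreover have "codifferent \<subseteq> K" by (auto simp: codifferent_def)
  moreover have "codifferent \<noteq> {0}" using \<open>1 \<in> codifferent\<close> by auto
  ultimately show ?thesis
    unfolding frac_ideal_def using codifferent_add codifferent_mult by blast
qed

lemma ideal_inv_mem: "x \<in> ideal_inv I \<longleftrightarrow> x \<in> K \<and> (\<forall>y\<in>I. x * y \<in> \<O>)"
  by (simp add: fideal_inv_def)

lemma frac_ideal_inv: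
  assumes I: "frac_ideal K I"
  shows "frac_ideal K (ideal_inv I)"
proof -
  obtain d where d: "d \<in> \<O>" "d \<noteq> 0" "\<And>x. x \<in> I \<Longrightarrow> d * x \<in> \<O>" using frac_idealD(6)[OF I] by blast
  obtain i where i: "i \<in> I" "i \<noteq> 0" using frac_idealD(3)[OF I] by blast
  have "d \<in> ideal_inv I" using d O_K by (auto simp: ideal_inv_mem)
  moreover have "(d * i) * x \<in> \<O>" if "x \<in> ideal_inv I" for x
    using that i d(1) mult_O[of d "x * i"] by (simp add: ideal_inv_mem mult_ac)
  moreover have "d * i \<in> \<O>" "d * i \<noteq> 0" using d i by auto
  moreover have "x + y \<in> ideal_inv I" if "x \<in> ideal_inv I" "y \<in> ideal_inv I" for x y
    using that by (auto simp: ideal_inv_mem distrib_right intro: add_K add_O)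
  moreover have "r * x \<in> ideal_inv I" if "r \<in> \<O>" "x \<in> ideal_inv I" for r x
    using that by (auto simp: ideal_inv_mem mult.assoc intro: mult_K O_K mult_O)
  moreover have "ideal_inv I \<subseteq> K" "0 \<in> ideal_inv I" by (auto simp: ideal_inv_mem)
  ultimately show ?thesis unfolding frac_ideal_def using d(2) by blast
qed

lemma different_eq: "different K = ideal_inv codifferent"
  by (simp add: different_def codifferent_def)

lemma frac_ideal_different: "frac_ideal K (different K)"
  unfolding different_eq by (intro frac_ideal_inv frac_ideal_codifferent)

lemma fideal_multI:
  assumes "x \<in> I" "y \<in> J"
  shows "x * y \<in> fideal_mult I J"
  unfolding fideal_mult_def mem_Collect_eq
  by (intro exI[of _ "1::nat"] exI[of _ "\<lambda>_. x"] exI[of _ "\<lambda>_. y"]) (use assms in simp)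

lemma fideal_mult_induct [consumes 1, case_names zero add]:
  assumes "x \<in> fideal_mult I J" "P 0" "\<And>a b z. a \<in> I \<Longrightarrow> b \<in> J \<Longrightarrow> P z \<Longrightarrow> P (a * b + z)"
  shows "P x"
proof -
  obtain m a b where x: "x = (\<Sum>k<m. a k * b k)" "\<forall>k<(m::nat). a k \<in> I \<and> b k \<in> J"
    using assms(1) by (auto simp: fideal_mult_def)
  have "P (\<Sum>k<m. a k * b k)" using x(2)
  proof (induction m)
    case (Suc m)
    then show ?case using assms(3)[of "a m" "b m" "\<Sum>k<m. a k * b k"] by (simp add: add.commute)
  qed (use assms(2) in simp)
  then show ?thesis using x by simp
qed

lemma fideal_mult_subset:
  assumes "frac_ideal K L" "\<And>x y. x \<in> I \<Longrightarrow> y \<in> J \<Longrightarrow> x * y \<in> L" "z \<in> fideal_mult I J"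
  shows "z \<in> L"
  using assms(3) by (induction rule: fideal_mult_induct) (use assms frac_idealD in auto)

lemma fideal_mult_0 [simp]: "0 \<in> fideal_mult I J"
  unfolding fideal_mult_def by (auto intro!: exI[of _ "0::nat"])

lemma fideal_mult_add:
  assumes "x \<in> fideal_mult I J" "y \<in> fideal_mult I J"
  shows "x + y \<in> fideal_mult I J"
proof -
  obtain m a b where x: "x = (\<Sum>k<m. a k * b k)" "\<forall>k<(m::nat). a k \<in> I \<and> b k \<in> J"
    using assms(1) by (auto simp: fideal_mult_def)
  obtain l c d where y: "y = (\<Sum>k<l. c k * d k)" "\<forall>k<(l::nat). c k \<in> I \<and> d k \<in> J"
    using assms(2) by (auto simp: fideal_mult_def)
  define f where "f = (\<lambda>k. if k < m then a k else c (k - m))"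
  define g where "g = (\<lambda>k. if k < m then b k else d (k - m))"
  have "(\<Sum>k<m + l. f k * g k) = (\<Sum>k<m. f k * g k) + (\<Sum>k<l. f (m + k) * g (m + k))"
    by (induction l) (simp_all add: add.assoc)
  also have "\<dots> = x + y" by (simp add: x y f_def g_def)
  finally have "x + y = (\<Sum>k<m + l. f k * g k)" ..
  moreover have "\<forall>k<m + l. f k \<in> I \<and> g k \<in> J" using x y by (auto simp: f_def g_def)
  ultimately show ?thesis unfolding fideal_mult_def by blast
qed

lemma frac_ideal_mult:
  assumes I: "frac_ideal K I" and J: "frac_ideal K J"
  shows "frac_ideal K (fideal_mult I J)"
proof -
  obtain d where d: "d \<in> \<O>" "d \<noteq> 0" "\<And>x. x \<in> I \<Longrightarrow> d * x \<in> \<O>" using frac_idealD(6)[OF I] by blast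
  obtain e where e: "e \<in> \<O>" "e \<noteq> 0" "\<And>x. x \<in> J \<Longrightarrow> e * x \<in> \<O>" using frac_idealD(6)[OF J] by blast
  obtain i where i: "i \<in> I" "i \<noteq> 0" using frac_idealD(3)[OF I] by blast
  obtain j where j: "j \<in> J" "j \<noteq> 0" using frac_idealD(3)[OF J] by blast
  have sub: "z \<in> K" if "z \<in> fideal_mult I J" for z
    using that by (induction rule: fideal_mult_induct) (auto intro: K_intros frac_idealD(1) I J)
  have scale: "r * z \<in> fideal_mult I J" if "r \<in> \<O>" "z \<in> fideal_mult I J" for r z
    using that(2)
  proof (induction rule: fideal_mult_induct)
    case (add a b z)
    then have "(r * a) * b + r * z \<in> fideal_mult I J"
      by (intro fideal_mult_add fideal_multI[of "r * a"] frac_idealD(5)[OF I that(1)])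
    then show ?case by (simp add: algebra_simps)
  qed simp
  have bound: "d * e * z \<in> \<O>" if "z \<in> fideal_mult I J" for z
    using that
  proof (induction rule: fideal_mult_induct)
    case (add a b z)
    then have "(d * a) * (e * b) + d * e * z \<in> \<O>"
      using d e by (intro add_O mult_O[of "d * a" "e * b"]) auto
    then show ?case by (simp add: algebra_simps)
  qed simp
  have "i * j \<in> fideal_mult I J" "i * j \<noteq> 0" using fideal_multI i j by auto
  then have "fideal_mult I J \<noteq> {0}" by blast
  moreover have "\<exists>d\<in>\<O>. d \<noteq> 0 \<and> (\<forall>x\<in>fideal_mult I J. d * x \<in> \<O>)"
    using bound d e by (intro bexI[of _ "d * e"]) (auto intro: mult_O)
  ultimately show ?thesis
    unfolding frac_ideal_def using sub scale fideal_mult_add fideal_mult_0 by blast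
qed

section \<open>Finiteness modulo a positive integer\<close>

text \<open>If d times the inverse of a is integral, then its product with a, namely d, lies in the
  ideal.\<close>

lemma nonzero_nat_in_ideal:
  assumes "int_ideal K I"
  obtains N :: nat where "N > 0" "of_nat N \<in> I"
proof -
  have I: "frac_ideal K I" using assms by (simp add: int_ideal_def)
  obtain a where a: "a \<in> I" "a \<noteq> 0" using frac_idealD(3)[OF I] by blast
  then have "inverse a \<in> K" using frac_idealD(1)[OF I] inverse_K by blast
  then obtain d :: nat where d: "d > 0" "algebraic_integer (of_nat d * inverse a)"
    using algebraic_integer_multiple by blast
  then have "of_nat d * inverse a \<in> \<O>"
    using \<open>inverse a \<in> K\<close> by (simp add: ring_of_integers_def mult_K)
  from frac_idealD(5)[OF I this a(1)] have "of_nat d \<in> I" using a(2) by (simp add: mult.assoc)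
  then show ?thesis using that d by blast
qed

lemma finite_residues:
  assumes "N > 0"
  obtains R where "finite R" "R \<subseteq> \<O>" "\<And>x. x \<in> \<O> \<Longrightarrow> \<exists>r\<in>R. \<exists>u\<in>\<O>. x = r + of_nat N * u"
proof -
  obtain S where S: "finite S" "\<O> = Z.span S" using fg_O by (auto simp: fg_def)
  define R where "R = (\<lambda>c. \<Sum>s\<in>S. of_int (c s) * s) ` (PiE S (\<lambda>_. {0..<int N}))"
  have SO: "S \<subseteq> \<O>" using S Z.span_superset by blast
  have "finite R" using S by (auto simp: R_def intro!: finite_PiE)
  moreover have "R \<subseteq> \<O>" using SO by (auto simp: R_def intro!: sum_O mult_O)
  moreover have "\<exists>r\<in>R. \<exists>u\<in>\<O>. x = r + of_nat N * u" if "x \<in> \<O>" for x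
  proof -
    obtain c :: "complex \<Rightarrow> int" where x: "x = (\<Sum>s\<in>S. of_int (c s) * s)"
      using \<open>x \<in> \<O>\<close> Z.span_finite[OF S(1)] S(2) by auto
    define r where "r = (\<Sum>s\<in>S. of_int (c s mod int N) * s)"
    define u where "u = (\<Sum>s\<in>S. of_int (c s div int N) * s)"
    have "of_int (c s) = (of_int (c s mod int N) + of_nat N * of_int (c s div int N) :: complex)" for s
    proof -
      have "(of_int (c s) :: complex) = of_int (c s mod int N + int N * (c s div int N))" by simp
      then show ?thesis by (simp only: of_int_add of_int_mult of_int_of_nat_eq)
    qed
    then have "x = r + of_nat N * u"
      unfolding x r_def u_def sum_distrib_left sum.distrib[symmetric]
      by (intro sum.cong refl) (metis distrib_right mult.assoc)
    moreover have "u \<in> \<O>" using SO by (auto simp: u_def intro!: sum_O mult_O)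
    moreover have "r \<in> R"
      unfolding R_def r_def using assms
      by (intro image_eqI[of _ _ "restrict (\<lambda>s. c s mod int N) S"] sum.cong) auto
    ultimately show ?thesis by blast
  qed
  ultimately show ?thesis using that by blast
qed

section \<open>Nakayama's lemma and invertibility\<close>

text \<open>The group \<open>A T + a \<O>\<close>. Both \<open>A = \<O>\<close> and
  \<open>A = J\<close> occur: passing from \<O> to \<open>J\<close> is what lets a generator be
  eliminated.\<close>

definition ideal_comb :: "complex \<Rightarrow> complex set \<Rightarrow> complex set \<Rightarrow> complex set" where
  "ideal_comb a A T = {(\<Sum>t\<in>T. c t * t) + a * w | c w. (\<forall>t\<in>T. c t \<in> A) \<and> w \<in> \<O>}"

lemma ideal_comb_add:
  assumes "int_ideal K A" "x \<in> ideal_comb a A T" "y \<in> ideal_comb a A T"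
  shows "x + y \<in> ideal_comb a A T"
proof -
  obtain c w where x: "x = (\<Sum>t\<in>T. c t * t) + a * w" "\<forall>t\<in>T. c t \<in> A" "w \<in> \<O>"
    using assms(2) by (auto simp: ideal_comb_def)
  obtain d v where y: "y = (\<Sum>t\<in>T. d t * t) + a * v" "\<forall>t\<in>T. d t \<in> A" "v \<in> \<O>"
    using assms(3) by (auto simp: ideal_comb_def)
  have "x + y = (\<Sum>t\<in>T. (c t + d t) * t) + a * (w + v)"
    by (simp add: x y algebra_simps sum.distrib)
  moreover have "\<forall>t\<in>T. c t + d t \<in> A" using x y assms(1) frac_idealD(4) by (auto simp: int_ideal_def)
  ultimately show ?thesis using add_O[OF x(3) y(3)] unfolding ideal_comb_def mem_Collect_eq
    by (intro exI[of _ "\<lambda>t. c t + d t"] exI[of _ "w + v"]) auto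
qed

lemma ideal_comb_scale:
  assumes "b \<in> \<O>" "x \<in> ideal_comb a A T" "\<And>c. c \<in> A \<Longrightarrow> b * c \<in> A'"
  shows "b * x \<in> ideal_comb a A' T"
proof -
  obtain c w where x: "x = (\<Sum>t\<in>T. c t * t) + a * w" "\<forall>t\<in>T. c t \<in> A" "w \<in> \<O>"
    using assms(2) by (auto simp: ideal_comb_def)
  have "b * x = (\<Sum>t\<in>T. (b * c t) * t) + a * (b * w)"
    by (simp add: x algebra_simps sum_distrib_left)
  then show ?thesis using mult_O[OF assms(1) x(3)] x(2) assms(3) unfolding ideal_comb_def mem_Collect_eq
    by (intro exI[of _ "\<lambda>t. b * c t"] exI[of _ "b * w"]) auto
qed

lemma ideal_comb_multiple:
  assumes "w \<in> \<O>" "0 \<in> A"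
  shows "a * w \<in> ideal_comb a A T"
  unfolding ideal_comb_def mem_Collect_eq
  by (intro exI[of _ "\<lambda>_. 0"] exI[of _ w]) (use assms in simp)

lemma ideal_comb_insert:
  assumes "finite T" "e \<notin> T" "x \<in> ideal_comb a A (insert e T)"
  obtains c y where "c \<in> A" "y \<in> ideal_comb a A T" "x = c * e + y"
proof -
  obtain c w where x: "x = (\<Sum>t\<in>insert e T. c t * t) + a * w" "\<forall>t\<in>insert e T. c t \<in> A" "w \<in> \<O>"
    using assms(3) by (auto simp: ideal_comb_def)
  have "(\<Sum>t\<in>T. c t * t) + a * w \<in> ideal_comb a A T"
    unfolding ideal_comb_def mem_Collect_eq using x by blast
  moreover have "x = c e * e + ((\<Sum>t\<in>T. c t * t) + a * w)" using assms x(1) by simp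
  ultimately show ?thesis using that x(2) by blast
qed

lemma int_ideal_O: "int_ideal K \<O>"
proof -
  have "\<O> \<noteq> {0}" using one_O by force
  moreover have "\<exists>d\<in>\<O>. d \<noteq> 0 \<and> (\<forall>x\<in>\<O>. d * x \<in> \<O>)" by (intro bexI[of _ 1]) auto
  ultimately show ?thesis
    by (auto simp: int_ideal_def frac_ideal_def add_O mult_O O_K)
qed

lemmas frac_ideal_O = int_ideal_O[unfolded int_ideal_def, THEN conjunct1]

text \<open>Nakayama's lemma modulo the principal ideal \<open>a\<O>\<close>: each step uses \<open>M \<subseteq> JM + a\<O>\<close> to
  eliminate one generator.\<close>
lemma nakayama:
  assumes J: "int_ideal K J" and a: "a \<in> \<O>"
    and M: "\<And>m. m \<in> M \<Longrightarrow> \<exists>x\<in>fideal_mult M J. \<exists>w\<in>\<O>. m = x + a * w"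
    and T: "finite T" "T \<subseteq> M" "\<And>m. m \<in> M \<Longrightarrow> m \<in> ideal_comb a \<O> T"
  obtains u where "u \<in> \<O>" "u - 1 \<in> J" "\<And>m. m \<in> M \<Longrightarrow> \<exists>w\<in>\<O>. u * m = a * w"
proof -
  have JO: "x \<in> \<O>" if "x \<in> J" for x using that J by (auto simp: int_ideal_def)
  have Jf: "frac_ideal K J" using J by (simp add: int_ideal_def)
  \<comment> \<open>The multiplier u stays congruent to 1 modulo \<open>J\<close> and carries
    \<open>M\<close> into combinations of \<open>T\<close>; it is generalised because each
    elimination changes it.\<close>
  have "\<exists>u\<in>\<O>. u - 1 \<in> J \<and> (\<forall>m\<in>M. u * m \<in> ideal_comb a \<O> {})"
    if "finite T" "T \<subseteq> M" "u \<in> \<O>" "u - 1 \<in> J" "\<And>m. m \<in> M \<Longrightarrow> u * m \<in> ideal_comb a \<O> T" for T u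
    using that
  proof (induction T arbitrary: u)
    case empty
    then show ?case by blast
  next
    case (insert e T)
    have J_comb: "u * x \<in> ideal_comb a J (insert e T)" if "x \<in> fideal_mult M J" for x
      using that
    proof (induction rule: fideal_mult_induct)
      case zero
      show ?case using ideal_comb_multiple[OF zero_O frac_idealD(2)[OF Jf]] by simp
    next
      case (add m b z)
      have "b * (u * m) \<in> ideal_comb a J (insert e T)"
        using insert.prems(4)[OF add(1)] add(2) JO
        by (rule_tac ideal_comb_scale) (auto simp: mult.commute[of b] intro: frac_idealD(5)[OF Jf])
      from ideal_comb_add[OF J this add(3)] show ?case by (simp add: algebra_simps)
    qed
    have "u * e \<in> ideal_comb a J (insert e T)"
    proof -
      have "e \<in> M" using insert.prems by simp
      then obtain x w where xw: "x \<in> fideal_mult M J" "w \<in> \<O>" "e = x + a * w" using M by blast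
      have "a * (u * w) \<in> ideal_comb a J (insert e T)"
        using xw insert.prems frac_idealD(2)[OF Jf] by (intro ideal_comb_multiple mult_O)
      from ideal_comb_add[OF J J_comb[OF xw(1)] this] show ?thesis by (simp add: xw(3) algebra_simps)
    qed
    \<comment> \<open>Here \<open>(u - c) * e = y\<close> no longer involves e, and
      \<open>u - c\<close> is again 1 modulo \<open>J\<close>. So \<open>(u - c) * u\<close> serves
      as multiplier for the smaller \<open>T\<close>.\<close>
    then obtain c y where cy: "c \<in> J" "y \<in> ideal_comb a J T" "u * e = c * e + y"
      using ideal_comb_insert[OF insert.hyps] by blast
    have y: "y \<in> ideal_comb a \<O> T" using ideal_comb_scale[OF one_O cy(2), of \<O>] JO by simp
    have uc: "u - c \<in> \<O>" using insert.prems cy JO by (intro diff_O)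
    show ?case
    proof (rule insert.IH)
      show "(u - c) * u \<in> \<O>" using uc insert.prems by (intro mult_O)
      have "u * (u - 1) + (u - 1) - u * c \<in> J"
        by (intro frac_ideal_diff[OF Jf] frac_idealD(4)[OF Jf] frac_idealD(5)[OF Jf, of u] insert.prems cy)
      then show "(u - c) * u - 1 \<in> J" by (simp add: algebra_simps)
      fix m assume m: "m \<in> M"
      obtain d z where dz: "d \<in> \<O>" "z \<in> ideal_comb a \<O> T" "u * m = d * e + z"
        using insert.prems(4)[OF m] insert.hyps by (rule_tac ideal_comb_insert)
      have "d * y + (u - c) * z \<in> ideal_comb a \<O> T"
        using dz y uc by (intro ideal_comb_add[OF int_ideal_O] ideal_comb_scale) (auto intro: mult_O)
      moreover have "(u - c) * u * m = d * ((u - c) * e) + (u - c) * z"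
        unfolding mult.assoc dz(3) by (simp add: algebra_simps)
      moreover have "(u - c) * e = y" using cy(3) by (simp add: algebra_simps)
      ultimately show "(u - c) * u * m \<in> ideal_comb a \<O> T" by simp
    qed (use insert.prems in auto)
  qed
  from this[OF T(1,2) one_O] T(3) frac_idealD(2)[OF Jf]
  obtain u where "u \<in> \<O>" "u - 1 \<in> J" "\<forall>m\<in>M. u * m \<in> ideal_comb a \<O> {}" by auto
  then show ?thesis by (intro that[of u]) (auto simp: ideal_comb_def)
qed

text \<open>Only finitely many ideals contain a given positive integer \<open>N\<close>, so there is a minimal
  ideal \<open>M\<close> containing \<open>N\<close> with trivial inverse; minimality gives \<open>M = MJ + N\<O>\<close>.\<close>
lemma one_in_ideal_if_trivial_inverse:
  assumes J: "int_ideal K J" and triv: "ideal_inv J \<subseteq> \<O>"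
  shows "1 \<in> J"
proof -
  have Jf: "frac_ideal K J" and JO: "J \<subseteq> \<O>" using J by (auto simp: int_ideal_def)
  obtain N :: nat where N: "N > 0" "of_nat N \<in> J" using nonzero_nat_in_ideal[OF J] by blast
  obtain R where R: "finite R" "R \<subseteq> \<O>" "\<And>x. x \<in> \<O> \<Longrightarrow> \<exists>r\<in>R. \<exists>u\<in>\<O>. x = r + of_nat N * u"
    using finite_residues[OF N(1)] by blast
  define F where "F = {M. int_ideal K M \<and> of_nat N \<in> M \<and> ideal_inv M \<subseteq> \<O>}"
  have NO: "of_nat N * u \<in> M" if "M \<in> F" "u \<in> \<O>" for M u
    using frac_idealD(5)[of M u "of_nat N"] that by (simp add: F_def int_ideal_def mult.commute)
  have res: "\<exists>r\<in>M \<inter> R. \<exists>u\<in>\<O>. m = r + of_nat N * u" if "M \<in> F" "m \<in> M" for M m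
  proof -
    have M: "frac_ideal K M" "M \<subseteq> \<O>" using that by (auto simp: F_def int_ideal_def)
    then obtain r u where ru: "r \<in> R" "u \<in> \<O>" "m = r + of_nat N * u" using R(3) \<open>m \<in> M\<close> by blast
    then have "r \<in> M" using frac_ideal_diff[OF M(1) \<open>m \<in> M\<close> NO[OF that(1) ru(2)]] by simp
    then show ?thesis using ru by blast
  qed
  \<comment> \<open>Members of \<open>F\<close> contain all multiples of N, so each is determined by
    the representatives in \<open>R\<close> that it contains; hence \<open>F\<close> is
    finite.\<close>
  have "inj_on (\<lambda>M. M \<inter> R) F"
  proof -
    have "M \<subseteq> M'" if MM: "M \<in> F" "M' \<in> F" "M \<inter> R = M' \<inter> R" for M M'
    proof
      fix m assume "m \<in> M"
      then obtain r u where "r \<in> M' \<inter> R" "u \<in> \<O>" "m = r + of_nat N * u" using res[OF MM(1)] MM(3) by blast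
      then show "m \<in> M'"
        using NO[OF MM(2)] frac_idealD(4)[of M' r] MM(2) by (simp add: F_def int_ideal_def)
    qed
    then show ?thesis by (intro inj_onI) blast
  qed
  moreover have "(\<lambda>M. M \<inter> R) ` F \<subseteq> Pow R" by auto
  ultimately have "finite F" using R(1) by (meson finite_Pow_iff inj_on_finite)
  moreover have "J \<in> F" using J N triv by (simp add: F_def)
  ultimately obtain M where M: "M \<in> F" "\<And>M'. M' \<in> F \<Longrightarrow> M' \<subseteq> M \<Longrightarrow> M = M'"
    using finite_has_minimal[of F] by blast
  have Mf: "frac_ideal K M" and MO: "M \<subseteq> \<O>" using M by (auto simp: F_def int_ideal_def)
  define M' where "M' = {x + of_nat N * w | x w. x \<in> fideal_mult M J \<and> w \<in> \<O>}"
  have MJ: "frac_ideal K (fideal_mult M J)" using Mf Jf by (rule frac_ideal_mult)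
  have MJ_M: "x \<in> M" if "x \<in> fideal_mult M J" for x
  proof (rule fideal_mult_subset[OF Mf _ that])
    show "a * b \<in> M" if "a \<in> M" "b \<in> J" for a b
      using that JO frac_idealD(5)[OF Mf, of b a] by (auto simp: mult.commute)
  qed
  have "M' \<subseteq> M" using MJ_M NO[OF M(1)] frac_idealD(4)[OF Mf] by (auto simp: M'_def)
  have M'I: "x + of_nat N * w \<in> M'" if "x \<in> fideal_mult M J" "w \<in> \<O>" for x w
    using that by (auto simp: M'_def)
  have "of_nat N \<in> M'" using M'I[of 0 1] by simp
  have "M' \<in> F"
    unfolding F_def mem_Collect_eq
  proof (intro conjI \<open>of_nat N \<in> M'\<close>)
    have "x + y \<in> M'" if "x \<in> M'" "y \<in> M'" for x y
    proof -
      obtain x' w y' v where *: "x = x' + of_nat N * w" "y = y' + of_nat N * v" "x' \<in> fideal_mult M J"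
        "y' \<in> fideal_mult M J" "w \<in> \<O>" "v \<in> \<O>" using \<open>x \<in> M'\<close> \<open>y \<in> M'\<close> by (auto simp: M'_def)
      have "x + y = (x' + y') + of_nat N * (w + v)" by (simp add: * algebra_simps)
      then show ?thesis using M'I[OF fideal_mult_add[OF *(3,4)] add_O[OF *(5,6)]] by (simp only:)
    qed
    moreover have "r * x \<in> M'" if "r \<in> \<O>" "x \<in> M'" for r x
    proof -
      obtain x' w where *: "x = x' + of_nat N * w" "x' \<in> fideal_mult M J" "w \<in> \<O>"
        using \<open>x \<in> M'\<close> by (auto simp: M'_def)
      have "r * x = r * x' + of_nat N * (r * w)" by (simp add: * algebra_simps)
      then show ?thesis
        using M'I[of "r * x'" "r * w"] * frac_idealD(5)[OF MJ that(1)] mult_O[OF that(1)] by auto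
    qed
    moreover have "M' \<subseteq> \<O>" using \<open>M' \<subseteq> M\<close> MO by blast
    moreover have "\<exists>d\<in>\<O>. d \<noteq> 0 \<and> (\<forall>x\<in>M'. d * x \<in> \<O>)"
      using \<open>M' \<subseteq> \<O>\<close> by (intro bexI[of _ 1]) auto
    moreover have "0 \<in> M'" using M'I[of 0 0] by simp
    moreover have "M' \<noteq> {0}" using \<open>of_nat N \<in> M'\<close> N(1) by auto
    ultimately show "int_ideal K M'" unfolding int_ideal_def frac_ideal_def using O_K by blast
    \<comment> \<open>For y in this inverse, \<open>y * m\<close> lies in the inverse of
      \<open>J\<close>, hence in \<O>; so y lies in the inverse of \<open>M\<close>, which is
      trivial as well.\<close>
    show "ideal_inv M' \<subseteq> \<O>"
    proof
      fix y assume y: "y \<in> ideal_inv M'"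
      have "y * m * j \<in> \<O>" if "m \<in> M" "j \<in> J" for m j
        using y M'I[OF fideal_multI[OF that] zero_O] by (simp add: ideal_inv_mem mult.assoc)
      moreover have "y * m \<in> K" if "m \<in> M" for m
        using y that frac_idealD(1)[OF Mf] mult_K by (simp add: ideal_inv_mem)
      ultimately have "y * m \<in> \<O>" if "m \<in> M" for m using triv that by (auto simp: ideal_inv_mem)
      then have "y \<in> ideal_inv M" using y by (simp add: ideal_inv_mem)
      then show "y \<in> \<O>" using M by (auto simp: F_def)
    qed
  qed
  then have "M = M'" using M(2) \<open>M' \<subseteq> M\<close> by blast
  then have M_eq: "\<exists>x\<in>fideal_mult M J. \<exists>w\<in>\<O>. m = x + of_nat N * w" if "m \<in> M" for m
    using that unfolding M'_def by blast
  have "m \<in> ideal_comb (of_nat N) \<O> (M \<inter> R)" if "m \<in> M" for m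
  proof -
    obtain r u where ru: "r \<in> M \<inter> R" "u \<in> \<O>" "m = r + of_nat N * u" using res[OF M(1) \<open>m \<in> M\<close>] by blast
    have "(\<Sum>t\<in>M \<inter> R. (if t = r then 1 else 0) * t) = (\<Sum>t\<in>M \<inter> R. if t = r then t else 0)"
      by (intro sum.cong) auto
    also have "\<dots> = r" using ru R(1) by simp
    finally show ?thesis using ru unfolding ideal_comb_def mem_Collect_eq
      by (intro exI[of _ "\<lambda>t. if t = r then 1 else 0"] exI[of _ u]) auto
  qed
  then obtain u where u: "u \<in> \<O>" "u - 1 \<in> J" "\<And>m. m \<in> M \<Longrightarrow> \<exists>w\<in>\<O>. u * m = of_nat N * w"
    using nakayama[OF J of_nat_O M_eq, of "M \<inter> R"] R(1) by (metis finite_Int inf_le1)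
  \<comment> \<open>Nakayama's multiplier divided by N is in the trivial inverse of
    \<open>M\<close>, so it is integral. Multiplying it by N, a member of \<open>J\<close>, puts u
    into \<open>J\<close>, and \<open>u - 1 \<in> J\<close> gives 1.\<close>
  have "u / of_nat N * m \<in> \<O>" if "m \<in> M" for m
    using u(3)[OF that] N(1) by auto
  then have "u / of_nat N \<in> ideal_inv M" using u(1) by (simp add: ideal_inv_mem divide_K O_K)
  then have "u / of_nat N \<in> \<O>" using M by (auto simp: F_def)
  from frac_idealD(5)[OF Jf this N(2)] have "u \<in> J" using N(1) by simp
  from frac_ideal_diff[OF Jf this u(2)] show ?thesis by simp
qed

text \<open>Apply the preceding lemma to the product of I and its inverse. An element of the inverse
  of that product stabilises the inverse of I, hence is integral.\<close>

theorem frac_ideal_invertible: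
  assumes I: "frac_ideal K I"
  shows "1 \<in> fideal_mult I (ideal_inv I)"
proof (rule one_in_ideal_if_trivial_inverse)
  have inv: "frac_ideal K (ideal_inv I)" using I by (rule frac_ideal_inv)
  have "z \<in> \<O>" if "z \<in> fideal_mult I (ideal_inv I)" for z
    using that by (intro fideal_mult_subset[OF frac_ideal_O _ that]) (auto simp: ideal_inv_mem mult.commute)
  then show "int_ideal K (fideal_mult I (ideal_inv I))"
    using frac_ideal_mult[OF I inv] by (auto simp: int_ideal_def)
  show "ideal_inv (fideal_mult I (ideal_inv I)) \<subseteq> \<O>"
  proof
    fix y assume y: "y \<in> ideal_inv (fideal_mult I (ideal_inv I))"
    then have yK: "y \<in> K" by (simp add: ideal_inv_mem)
    have stable: "y * k \<in> ideal_inv I" if "k \<in> ideal_inv I" for k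
    proof -
      have "y * k * i \<in> \<O>" if "i \<in> I" for i
      proof -
        have "y * (i * k) \<in> \<O>"
          using y fideal_multI[OF that \<open>k \<in> ideal_inv I\<close>] by (simp add: ideal_inv_mem)
        then show ?thesis by (simp add: mult_ac)
      qed
      then show ?thesis using yK that by (simp add: ideal_inv_mem mult_K)
    qed
    obtain m where m: "m \<in> ideal_inv I" "m \<noteq> 0" using frac_idealD(3)[OF inv] by blast
    obtain i where i: "i \<in> I" "i \<noteq> 0" using frac_idealD(3)[OF I] by blast
    have "y ^ k * m \<in> ideal_inv I" for k
      by (induction k) (use m stable in \<open>auto simp: mult.assoc\<close>)
    then have "i * (y ^ k * m) \<in> \<O>" for k
      using i(1) by (simp add: ideal_inv_mem mult.commute)
    then show "y \<in> \<O>" using m(2) i(2) yK by (rule_tac integrally_closed)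
  qed
qed

text \<open>As 1 is a sum of products \<open>i * k\<close>, membership may be tested after
  multiplying by such products. This takes the place of localisation wherever an ideal has to be
  cancelled below.\<close>

lemma ideal_cancel:
  assumes I: "frac_ideal K I" and L: "frac_ideal K L"
    and mem: "\<And>i k. i \<in> I \<Longrightarrow> k \<in> ideal_inv I \<Longrightarrow> x * (i * k) \<in> L"
  shows "x \<in> L"
proof -
  have "x * z \<in> L" if "z \<in> fideal_mult I (ideal_inv I)" for z
    using that
    by (induction rule: fideal_mult_induct) (auto simp: distrib_left mem frac_idealD[OF L])
  from this[OF frac_ideal_invertible[OF I]] show ?thesis by simp
qed

end

section \<open>Matrices and cosets\<close>

lemma mat2_mult_assoc: "mat2_mult (mat2_mult L M) N = mat2_mult L (mat2_mult M N)"
  by (cases L; cases M; cases N) (simp add: algebra_simps)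

lemma mat2_mult_one: "mat2_mult (1, 0, 0, 1) M = M"
  by (cases M) simp

lemma left_coset_mult_eq:
  assumes "\<And>L M. L \<in> G \<Longrightarrow> M \<in> G \<Longrightarrow> mat2_mult L M \<in> G"
    and "g \<in> G" "g' \<in> G" "mat2_mult g' g = (1, 0, 0, 1)"
  shows "left_coset G (mat2_mult g M) = left_coset G M"
proof
  show "left_coset G (mat2_mult g M) \<subseteq> left_coset G M"
  proof
    fix x assume "x \<in> left_coset G (mat2_mult g M)"
    then obtain h where h: "h \<in> G" "x = mat2_mult (mat2_mult h g) M"
      by (auto simp: left_coset_def mat2_mult_assoc)
    then show "x \<in> left_coset G M" using assms(1)[OF h(1) assms(2)] unfolding left_coset_def by blast
  qed
  show "left_coset G M \<subseteq> left_coset G (mat2_mult g M)"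
  proof
    fix x assume "x \<in> left_coset G M"
    then obtain h where h: "h \<in> G" "x = mat2_mult h M" by (auto simp: left_coset_def)
    have "mat2_mult (mat2_mult h g') (mat2_mult g M) = x"
      unfolding h(2) using assms(4) by (metis mat2_mult_assoc mat2_mult_one)
    then show "x \<in> left_coset G (mat2_mult g M)"
      using assms(1)[OF h(1) assms(3)] unfolding left_coset_def by blast
  qed
qed

section \<open>Total positivity, inverses of products, units\<close>

context num_field
begin

lemma totally_positive_nonzero: "totally_positive K x \<Longrightarrow> x \<noteq> 0"
  using emb_id emb_zero[OF emb_id] by (auto simp: totally_positive_def)

lemma totally_positive_one: "totally_positive K 1"
  by (simp add: totally_positive_def emb_one)

lemma totally_positive_mult:
  assumes "totally_positive K x" "totally_positive K y"
  shows "totally_positive K (x * y)"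
  using assms by (auto simp: totally_positive_def mult_K emb_mult elim!: Reals_cases)

lemma ideal_inv_mult_cancel:
  assumes J: "frac_ideal K J" and x: "x \<in> fideal_mult I J" and k: "k \<in> ideal_inv I"
  shows "k * x \<in> J"
  using x
proof (induction rule: fideal_mult_induct)
  case (add a b z)
  have "k * a \<in> \<O>" using k add(1) by (simp add: ideal_inv_mem)
  then have "(k * a) * b + k * z \<in> J"
    using frac_idealD(4)[OF J frac_idealD(5)[OF J _ add(2)] add(3)] by blast
  then show ?case by (simp add: algebra_simps)
qed (use frac_idealD(2)[OF J] in simp)

lemma mult_ideal_inv_cancel:
  assumes J: "frac_ideal K J" and x: "x \<in> fideal_mult J (ideal_inv I)" and i: "i \<in> I"
  shows "x * i \<in> J"
  using x
proof (induction rule: fideal_mult_induct)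
  case (add a b z)
  have "b * i \<in> \<O>" using i add(2) by (simp add: ideal_inv_mem)
  then have "(b * i) * a + z * i \<in> J"
    using frac_idealD(4)[OF J frac_idealD(5)[OF J _ add(1)] add(3)] by blast
  then show ?case by (simp add: algebra_simps)
qed (use frac_idealD(2)[OF J] in simp)

text \<open>This converse of \<open>mult_ideal_inv_cancel\<close> is where invertibility of
  \<open>I\<close> enters.\<close>

lemma mult_ideal_invI:
  assumes I: "frac_ideal K I" and J: "frac_ideal K J" and y: "\<And>i. i \<in> I \<Longrightarrow> y * i \<in> J"
  shows "y \<in> fideal_mult J (ideal_inv I)"
proof (rule ideal_cancel[OF I frac_ideal_mult[OF J frac_ideal_inv[OF I]]])
  fix i k assume "i \<in> I" "k \<in> ideal_inv I"
  then have "y * i * k \<in> fideal_mult J (ideal_inv I)" using y by (intro fideal_multI)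
  then show "y * (i * k) \<in> fideal_mult J (ideal_inv I)" by (simp add: mult.assoc)
qed

lemma ideal_inv_multI:
  assumes s: "s \<in> ideal_inv I" and k: "k \<in> ideal_inv J"
  shows "s * k \<in> ideal_inv (fideal_mult I J)"
proof -
  have "s * k * x \<in> \<O>" if "x \<in> fideal_mult I J" for x
    using that
  proof (induction rule: fideal_mult_induct)
    case (add a b z)
    have "(s * a) * (k * b) + s * k * z \<in> \<O>"
      using s k add by (intro add_O mult_O[of "s * a"]) (auto simp: ideal_inv_mem)
    then show ?case by (simp add: algebra_simps)
  qed simp
  then show ?thesis using s k by (auto simp: ideal_inv_mem intro: mult_K)
qed

lemma ideal_inv_mult_right:
  assumes "frac_ideal K I" "x \<in> ideal_inv (fideal_mult I J)" "i \<in> I"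
  shows "x * i \<in> ideal_inv J"
  using assms fideal_multI[of i I _ J] frac_idealD(1)[OF assms(1)]
  by (auto simp: ideal_inv_mem mult.assoc intro: mult_K)

lemma ideal_inv_mult_left:
  assumes "frac_ideal K J" "x \<in> ideal_inv (fideal_mult I J)" "j \<in> J"
  shows "x * j \<in> ideal_inv I"
  using assms fideal_multI[of _ I j J] frac_idealD(1)[OF assms(1)]
  by (auto simp: ideal_inv_mem mult.assoc mult.commute[of j] intro: mult_K)

lemma unitsD:
  assumes "x \<in> nf_units K"
  shows "x \<in> \<O>" "x \<noteq> 0" "inverse x \<in> \<O>" "x \<in> K"
  using assms O_K by (auto simp: nf_units_def)

lemma units_mult: "x \<in> nf_units K \<Longrightarrow> y \<in> nf_units K \<Longrightarrow> x * y \<in> nf_units K"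
  by (auto simp: nf_units_def intro: mult_O)

lemma units_factor:
  assumes "x \<in> \<O>" "z \<in> \<O>" "x * z \<in> nf_units K"
  shows "x \<in> nf_units K"
proof -
  have "inverse x = z * inverse (x * z)" using unitsD(2)[OF assms(3)] by (simp add: field_simps)
  also have "\<dots> \<in> \<O>" using assms(2) unitsD[OF assms(3)] by (intro mult_O)
  finally show ?thesis using assms(1) unitsD(2)[OF assms(3)] by (auto simp: nf_units_def)
qed

end

section \<open>The congruence group\<close>

locale level = num_field +
  fixes n t :: "complex set"
  assumes totally_real: "totally_real K" and int_ideal_n: "int_ideal K n" and frac_ideal_t: "frac_ideal K t"
begin

definition q :: "complex set" where
  "q = fideal_mult t (different K)"

abbreviation "\<Gamma> \<equiv> Gamma1 K t n"

lemma frac_ideal_q: "frac_ideal K q"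
  unfolding q_def by (intro frac_ideal_mult frac_ideal_t frac_ideal_different)

lemma frac_ideal_qi: "frac_ideal K (ideal_inv q)"
  by (intro frac_ideal_inv frac_ideal_q)

lemma frac_ideal_n: "frac_ideal K n" and n_O: "x \<in> n \<Longrightarrow> x \<in> \<O>"
  using int_ideal_n by (auto simp: int_ideal_def)

lemma frac_ideal_qn: "frac_ideal K (fideal_mult q n)"
  by (intro frac_ideal_mult frac_ideal_q frac_ideal_n)

lemmas qi_add = frac_idealD(4)[OF frac_ideal_qi] and qi_scale = frac_idealD(5)[OF frac_ideal_qi]
  and qi_diff = frac_ideal_diff[OF frac_ideal_qi]
lemmas n_add = frac_idealD(4)[OF frac_ideal_n] and n_scale = frac_idealD(5)[OF frac_ideal_n]
  and n_diff = frac_ideal_diff[OF frac_ideal_n]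
lemmas qn_add = frac_idealD(4)[OF frac_ideal_qn] and qn_scale = frac_idealD(5)[OF frac_ideal_qn]

lemma emb_real: "\<sigma> \<in> E \<Longrightarrow> x \<in> K \<Longrightarrow> \<sigma> x \<in> \<real>"
  using totally_real by (auto simp: totally_real_def)

text \<open>In a totally real field nonzero squares are totally positive, which allows passing
  between x z and z / x.\<close>

lemma totally_positive_mult_square:
  assumes "totally_positive K w" "s \<in> K" "s \<noteq> 0"
  shows "totally_positive K (w * (s * s))"
proof (rule totally_positive_mult[OF assms(1)])
  have "\<sigma> (s * s) \<in> \<real> \<and> Re (\<sigma> (s * s)) > 0" if "\<sigma> \<in> E" for \<sigma>
    using emb_real[OF that assms(2)] emb_nonzero[OF that assms(2,3)] emb_mult[OF that assms(2,2)]
    by (auto elim!: Reals_cases) (metis not_square_less_zero linorder_neqE_linordered_idom mult_eq_0_iff)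
  then show "totally_positive K (s * s)" using assms(2) by (simp add: totally_positive_def mult_K)
qed

lemma norm_mult:
  assumes "x \<in> K" "y \<in> K"
  shows "nf_norm K (x * y) = nf_norm K x * nf_norm K y"
proof -
  have "(\<Prod>\<sigma>\<in>E. \<sigma> x) \<in> \<real>" "(\<Prod>\<sigma>\<in>E. \<sigma> y) \<in> \<real>"
    using assms emb_real by (auto intro: prod_in_Reals)
  moreover have "(\<Prod>\<sigma>\<in>E. \<sigma> (x * y)) = (\<Prod>\<sigma>\<in>E. \<sigma> x) * (\<Prod>\<sigma>\<in>E. \<sigma> y)"
    using assms by (simp add: emb_mult prod.distrib)
  ultimately show ?thesis by (auto simp: nf_norm_def elim!: Reals_cases)
qed

lemma norm_totally_positive:
  assumes "totally_positive K x"
  shows "nf_norm K x > 0"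
proof -
  have "(\<Prod>\<sigma>\<in>E. \<sigma> x) = (\<Prod>\<sigma>\<in>E. of_real (Re (\<sigma> x)))"
    using assms by (intro prod.cong) (auto simp: totally_positive_def)
  then have "nf_norm K x = (\<Prod>\<sigma>\<in>E. Re (\<sigma> x))" unfolding nf_norm_def by (simp flip: of_real_prod)
  then show ?thesis using assms by (auto simp: totally_positive_def intro: prod_pos)
qed

lemma Gamma_iff:
  "(a, b, c, d) \<in> \<Gamma> \<longleftrightarrow> a \<in> \<O> \<and> d \<in> \<O> \<and> c \<in> fideal_mult q n \<and> b \<in> ideal_inv q \<and>
     a * d - b * c \<in> nf_units K \<and> totally_positive K (a * d - b * c) \<and> d - 1 \<in> n"
  using frac_idealD(1)[OF frac_ideal_qn] frac_idealD(1)[OF frac_ideal_qi] O_K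
  by (auto simp: Gamma1_def GL2_plus_def cong_mod_def q_def)

text \<open>Products of off-diagonal entries vanish modulo n, so the lower right entry is
  multiplicative modulo n.\<close>

lemma qn_qi: "c \<in> fideal_mult q n \<Longrightarrow> b \<in> ideal_inv q \<Longrightarrow> b * c \<in> n"
  using ideal_inv_mult_cancel[OF frac_ideal_n] by blast

lemma Gamma_mult:
  assumes "L \<in> \<Gamma>" "M \<in> \<Gamma>"
  shows "mat2_mult L M \<in> \<Gamma>"
proof -
  obtain a b c d a' b' c' d' where LM: "L = (a, b, c, d)" "M = (a', b', c', d')" by (cases L; cases M)
  have L: "a \<in> \<O>" "d \<in> \<O>" "c \<in> fideal_mult q n" "b \<in> ideal_inv q"
     "a * d - b * c \<in> nf_units K" "totally_positive K (a * d - b * c)" "d - 1 \<in> n"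
    using assms(1) by (simp_all add: LM Gamma_iff)
  have M: "a' \<in> \<O>" "d' \<in> \<O>" "c' \<in> fideal_mult q n" "b' \<in> ideal_inv q"
     "a' * d' - b' * c' \<in> nf_units K" "totally_positive K (a' * d' - b' * c')" "d' - 1 \<in> n"
    using assms(2) by (simp_all add: LM Gamma_iff)
  have n: "b * c' \<in> n" "b' * c \<in> n" using L M by (auto intro: qn_qi)
  have det: "(a * a' + b * c') * (c * b' + d * d') - (a * b' + b * d') * (c * a' + d * c') =
      (a * d - b * c) * (a' * d' - b' * c')" by (simp add: algebra_simps)
  have "b' * c + d' * (d - 1) + (d' - 1) \<in> n"
    by (rule n_add[OF n_add[OF n(2) n_scale[OF M(2) L(7)]] M(7)])
  then have "c * b' + d * d' - 1 \<in> n" by (simp add: algebra_simps)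
  moreover have "a * b' + d' * b \<in> ideal_inv q"
    by (rule qi_add[OF qi_scale[OF L(1) M(4)] qi_scale[OF M(2) L(4)]])
  moreover have "a' * c + d * c' \<in> fideal_mult q n"
    by (rule qn_add[OF qn_scale[OF M(1) L(3)] qn_scale[OF L(2) M(3)]])
  moreover have "a * a' + b * c' \<in> \<O>" by (rule add_O[OF mult_O[OF L(1) M(1)] n_O[OF n(1)]])
  moreover have "c * b' + d * d' \<in> \<O>" 
    using add_O[OF n_O[OF n(2)] mult_O[OF L(2) M(2)]] by (simp add: mult.commute)
  ultimately show ?thesis
    unfolding LM mat2_mult.simps Gamma_iff det
    using units_mult[OF L(5) M(5)] totally_positive_mult[OF L(6) M(6)] by (simp add: mult.commute)
qed

lemma Gamma_one: "(1, 0, 0, 1) \<in> \<Gamma>"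
  using frac_idealD(2)[OF frac_ideal_n] frac_idealD(2)[OF frac_ideal_qi] totally_positive_one
  by (simp add: Gamma_iff nf_units_def)

lemma Gamma_inverse:
  assumes "L \<in> \<Gamma>"
  obtains L' where "L' \<in> \<Gamma>" "mat2_mult L' L = (1, 0, 0, 1)"
proof -
  obtain a b c d where LM: "L = (a, b, c, d)" by (cases L)
  define D where "D = a * d - b * c"
  define u where "u = inverse D"
  have L: "a \<in> \<O>" "d \<in> \<O>" "c \<in> fideal_mult q n" "b \<in> ideal_inv q"
     "D \<in> nf_units K" "totally_positive K D" "d - 1 \<in> n"
    using assms(1) by (simp_all add: LM Gamma_iff D_def)
  have u: "u \<in> \<O>" "u \<in> nf_units K" "u \<noteq> 0" "u * D = 1"
    using unitsD[OF L(5)] by (auto simp: u_def nf_units_def)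
  have "b * c \<in> n" using L by (auto intro: qn_qi)
  \<comment> \<open>From \<open>b * c \<in> n\<close> and d congruent to 1 one gets a congruent to
    \<open>D\<close> modulo n. Scaled by u, this is the congruence for the lower right entry
    \<open>u * a\<close> of the inverse.\<close>
  then have "u * (b * c) - u * a * (d - 1) \<in> n"
    by (rule n_diff[OF n_scale[OF u(1)] n_scale[OF mult_O[OF u(1) L(1)] L(7)]])
  also have "u * (b * c) - u * a * (d - 1) = u * a - u * D" by (simp add: D_def algebra_simps)
  finally have n: "u * a - 1 \<in> n" using u by simp
  have det: "u * d * (u * a) - - u * b * (- u * c) = u * (u * D)" by (simp add: D_def algebra_simps)
  \<comment> \<open>This product is u itself, the determinant of the inverse.\<close>
  have "totally_positive K (D * (u * u))"
    using L u O_K by (intro totally_positive_mult_square)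
  then have tp: "totally_positive K u" using u(4) by (simp add: mult.commute mult.left_commute[of D])
  have "(u * d, - u * b, - u * c, u * a) \<in> \<Gamma>"
    unfolding Gamma_iff det using u L n tp minus_O
    by (auto intro: mult_O frac_idealD(5)[OF frac_ideal_qn] frac_idealD(5)[OF frac_ideal_qi]
        simp del: mult_minus_left)
  moreover have "mat2_mult (u * d, - u * b, - u * c, u * a) L = (1, 0, 0, 1)"
    using u(4) by (simp add: LM D_def algebra_simps)
  ultimately show ?thesis using that by blast
qed

section \<open>Ideals attached to a matrix\<close>

context
  fixes a b c d :: complex
  assumes A: "(a, b, c, d) \<in> GL2_plus K"
begin

definition "bi = b_ideal K t (a, b, c, d)"

text \<open>Its multiple by c is the ideal \<open>c_ideal\<close>; naming the factor without c keeps
  the case c = 0 uniform.\<close>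

definition "qbi = ideal_inv (fideal_mult q bi)"

definition "m = m_ideal K t n (a, b, c, d)"

lemma A_K: "a \<in> K" "b \<in> K" "c \<in> K" "d \<in> K" and A_det: "a * d - b * c \<noteq> 0"
proof -
  show "a \<in> K" "b \<in> K" "c \<in> K" "d \<in> K" using A by (simp_all add: GL2_plus_def)
  show "a * d - b * c \<noteq> 0" by (rule totally_positive_nonzero) (use A in \<open>simp add: GL2_plus_def\<close>)
qed

lemma bi_iff: "x \<in> bi \<longleftrightarrow> (\<exists>r\<in>\<O>. \<exists>s\<in>ideal_inv q. x = a * r + c * s)"
  by (auto simp: bi_def fideal_add_def elt_mult_def q_def)

lemma frac_ideal_bi: "frac_ideal K bi"
proof -
  have ab: "a * r + c * s \<in> bi" if "r \<in> \<O>" "s \<in> ideal_inv q" for r s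
    using that bi_iff by blast
  have "0 \<in> ideal_inv q" by (rule frac_idealD(2)[OF frac_ideal_qi])
  obtain s where s: "s \<in> ideal_inv q" "s \<noteq> 0" using frac_idealD(3)[OF frac_ideal_qi] by blast
  have "a \<in> bi" "c * s \<in> bi"
    using ab[OF one_O \<open>0 \<in> ideal_inv q\<close>] ab[OF zero_O s(1)] by simp_all
  moreover have "a \<noteq> 0 \<or> c * s \<noteq> 0" using A_det s by auto
  ultimately have ne: "bi \<noteq> {0}" by blast
  have "0 \<in> bi" using ab[OF zero_O \<open>0 \<in> ideal_inv q\<close>] by simp
  have sub: "bi \<subseteq> K"
    using A_K O_K frac_idealD(1)[OF frac_ideal_qi] by (auto simp: bi_iff intro!: add_K mult_K)
  have add: "x + y \<in> bi" if xy: "x \<in> bi" "y \<in> bi" for x y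
  proof -
    obtain r s r' s' where *: "x = a * r + c * s" "y = a * r' + c * s'" "r \<in> \<O>" "r' \<in> \<O>"
      "s \<in> ideal_inv q" "s' \<in> ideal_inv q" using xy unfolding bi_iff by blast
    have "a * (r + r') + c * (s + s') \<in> bi" using * by (intro ab add_O qi_add)
    then show ?thesis by (simp add: * algebra_simps)
  qed
  have scale: "r * x \<in> bi" if rx: "r \<in> \<O>" "x \<in> bi" for r x
  proof -
    obtain r' s where *: "x = a * r' + c * s" "r' \<in> \<O>" "s \<in> ideal_inv q" using rx(2) by (auto simp: bi_iff)
    have "a * (r * r') + c * (r * s) \<in> bi" using * rx(1) by (intro ab mult_O qi_scale)
    then show ?thesis by (simp add: * algebra_simps)
  qed
  obtain e where e: "e \<in> \<O>" "e \<noteq> 0" "\<And>s. s \<in> ideal_inv q \<Longrightarrow> e * s \<in> \<O>"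
    using frac_idealD(6)[OF frac_ideal_qi] by blast
  obtain i :: nat where i: "i > 0" "algebraic_integer (of_nat i * a)"
    using algebraic_integer_multiple A_K by blast
  obtain j :: nat where j: "j > 0" "algebraic_integer (of_nat j * c)"
    using algebraic_integer_multiple A_K by blast
  have ij: "of_nat i * a \<in> \<O>" "of_nat j * c \<in> \<O>" using i j A_K by (auto simp: ring_of_integers_def mult_K)
  have "of_nat i * of_nat j * e * x \<in> \<O>" if x: "x \<in> bi" for x
  proof -
    obtain r s where *: "x = a * r + c * s" "r \<in> \<O>" "s \<in> ideal_inv q" using x by (auto simp: bi_iff)
    have "(of_nat i * a) * (of_nat j * (e * r)) + of_nat i * ((of_nat j * c) * (e * s)) \<in> \<O>"
      by (intro add_O mult_O[OF ij(1)] mult_O[OF of_nat_O] mult_O[OF ij(2)] mult_O[OF e(1) *(2)] e(3)[OF *(3)])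
    then show ?thesis by (simp add: * algebra_simps)
  qed
  moreover have "of_nat i * of_nat j * e \<in> \<O>" "of_nat i * of_nat j * e \<noteq> 0"
    using i j e by (auto intro!: mult_O)
  ultimately have "\<exists>d\<in>\<O>. d \<noteq> 0 \<and> (\<forall>x\<in>bi. d * x \<in> \<O>)" by blast
  then show ?thesis unfolding frac_ideal_def using sub \<open>0 \<in> bi\<close> ne add scale by blast
qed

lemma frac_ideal_qbi: "frac_ideal K qbi"
  unfolding qbi_def by (intro frac_ideal_inv frac_ideal_mult frac_ideal_q frac_ideal_bi)

lemma bi_inv:
  assumes "k \<in> ideal_inv bi"
  shows "k * a \<in> \<O>" "s \<in> ideal_inv q \<Longrightarrow> k * c * s \<in> \<O>"
proof -
  have "a * 1 + c * 0 \<in> bi" using frac_idealD(2)[OF frac_ideal_qi] one_O bi_iff by blast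
  then show "k * a \<in> \<O>" using assms by (auto simp: ideal_inv_mem)
  assume "s \<in> ideal_inv q"
  then have "a * 0 + c * s \<in> bi" using zero_O bi_iff by blast
  then show "k * c * s \<in> \<O>" using assms by (auto simp: ideal_inv_mem mult.assoc)
qed

text \<open>Together with \<open>bi_inv\<close> this says that multiples of the column
  \<open>(a, c)\<close> by the inverse of \<open>bi\<close> lie in the lattice formed by \<O> and
  \<open>q\<close>.\<close>

lemma bi_inv_q:
  assumes "k \<in> ideal_inv bi"
  shows "k * c \<in> q"
proof (rule ideal_cancel[OF frac_ideal_q frac_ideal_q])
  fix i l assume "i \<in> q" "l \<in> ideal_inv q"
  then have "(k * c * l) * i \<in> q" using bi_inv(2)[OF assms] by (intro frac_idealD(5)[OF frac_ideal_q])
  then show "k * c * (i * l) \<in> q" by (simp add: mult_ac)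
qed

lemma c_qbi_O:
  assumes k: "k \<in> qbi"
  shows "c * k \<in> \<O>"
proof (rule ideal_cancel[OF frac_ideal_q frac_ideal_O])
  fix i l assume il: "i \<in> q" "l \<in> ideal_inv q"
  have "k * i \<in> ideal_inv bi" using k il frac_ideal_q unfolding qbi_def by (intro ideal_inv_mult_right)
  then have "k * i * c * l \<in> \<O>" using il by (intro bi_inv)
  then show "c * k * (i * l) \<in> \<O>" by (simp add: mult_ac)
qed

text \<open>Used to place the upper right entry of the constructed matrix in the inverse of
  \<open>q\<close>.\<close>

lemma a_qbi:
  assumes k: "k \<in> qbi"
  shows "a * k \<in> ideal_inv q"
proof -
  have "a * 1 + c * 0 \<in> bi" using frac_idealD(2)[OF frac_ideal_qi] one_O bi_iff by blast
  then have "k * a \<in> ideal_inv q"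
    using k unfolding qbi_def by (intro ideal_inv_mult_left[OF frac_ideal_bi]) auto
  then show ?thesis by (simp add: mult.commute)
qed

lemma m_iff: "x \<in> m \<longleftrightarrow> (\<exists>k\<in>qbi. \<exists>r\<in>n. x = c * k + r)"
  by (auto simp: m_def m_ideal_def fideal_add_def elt_mult_def bi_def[symmetric] qbi_def q_def simp del: b_ideal.simps)

lemma frac_ideal_m: "frac_ideal K m"
proof -
  have mI: "c * k + r \<in> m" if "k \<in> qbi" "r \<in> n" for k r
    using that m_iff by blast
  have zero: "0 \<in> qbi" using frac_idealD(2)[OF frac_ideal_qbi] .
  have nm: "r \<in> m" if "r \<in> n" for r using mI[OF zero that] by simp
  have sub: "x \<in> \<O>" if "x \<in> m" for x using that c_qbi_O n_O by (auto simp: m_iff intro: add_O)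
  have "x + y \<in> m" if xy: "x \<in> m" "y \<in> m" for x y
  proof -
    obtain k r k' r' where *: "x = c * k + r" "y = c * k' + r'" "k \<in> qbi" "k' \<in> qbi" "r \<in> n" "r' \<in> n"
      using xy unfolding m_iff by blast
    have "c * (k + k') + (r + r') \<in> m" using * by (intro mI n_add frac_idealD(4)[OF frac_ideal_qbi])
    then show ?thesis by (simp add: * algebra_simps)
  qed
  moreover have "s * x \<in> m" if sx: "s \<in> \<O>" "x \<in> m" for s x
  proof -
    obtain k r where *: "x = c * k + r" "k \<in> qbi" "r \<in> n" using sx(2) by (auto simp: m_iff)
    have "c * (s * k) + s * r \<in> m" using * sx(1) by (intro mI n_scale frac_idealD(5)[OF frac_ideal_qbi])
    then show ?thesis by (simp add: * algebra_simps)
  qed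
  moreover have "0 \<in> m" using nm frac_idealD(2)[OF frac_ideal_n] by blast
  moreover have "m \<noteq> {0}" using nm frac_idealD(3)[OF frac_ideal_n] by blast
  moreover have "\<exists>d\<in>\<O>. d \<noteq> 0 \<and> (\<forall>x\<in>m. d * x \<in> \<O>)" using sub by (intro bexI[of _ 1]) auto
  moreover have "m \<subseteq> K" using sub O_K by blast
  ultimately show ?thesis unfolding frac_ideal_def by blast
qed

text \<open>The ideals \<open>\<aa>\<close> and \<open>\<cc>\<close> of the pair are coprime.\<close>
lemma bezout:
  obtains k l where "k \<in> ideal_inv bi" "l \<in> qbi" "k * a + l * c = 1"
proof -
  have binv: "frac_ideal K (ideal_inv bi)" by (intro frac_ideal_inv frac_ideal_bi)
  \<comment> \<open>Each generator of \<open>bi\<close> has the form \<open>a * r + c * s\<close>;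
    multiplying by h yields the coefficients \<open>r * h\<close> and \<open>s * h\<close> of a and
    c.\<close>
  have "\<exists>k\<in>ideal_inv bi. \<exists>l\<in>qbi. z = k * a + l * c" if "z \<in> fideal_mult bi (ideal_inv bi)" for z
    using that
  proof (induction rule: fideal_mult_induct)
    case zero
    have "0 = 0 * a + 0 * c" by simp
    then show ?case using frac_idealD(2)[OF binv] frac_idealD(2)[OF frac_ideal_qbi] by blast
  next
    case (add i h z)
    then obtain k l where kl: "k \<in> ideal_inv bi" "l \<in> qbi" "z = k * a + l * c" by blast
    obtain r s where rs: "r \<in> \<O>" "s \<in> ideal_inv q" "i = a * r + c * s" using add(1) by (auto simp: bi_iff)
    have "r * h + k \<in> ideal_inv bi" using rs add kl by (intro frac_idealD(4,5)[OF binv])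
    moreover have "s * h + l \<in> qbi"
      using rs add kl unfolding qbi_def
      by (intro frac_idealD(4)[OF frac_ideal_qbi[unfolded qbi_def]] ideal_inv_multI)
    moreover have "i * h + z = (r * h + k) * a + (s * h + l) * c" by (simp add: rs kl algebra_simps)
    ultimately show ?case by blast
  qed
  from this[OF frac_ideal_invertible[OF frac_ideal_bi]] show ?thesis using that by metis
qed

section \<open>Eigenvalues and their congruences\<close>

text \<open>The hypotheses on \<open>z\<close> say that \<open>(- c, a)\<close> is a left eigenvector.\<close>
lemma eigenvalue_congruences:
  assumes G: "(\<alpha>, \<beta>, g, \<delta>) \<in> \<Gamma>"
    and x: "\<alpha> * a + \<beta> * c = a * x" "g * a + \<delta> * c = c * x" "x \<in> K"
    and z: "z * a = a * \<delta> - c * \<beta>" "z * c = c * \<alpha> - a * g" "z \<in> K"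
    and det: "\<alpha> * \<delta> - \<beta> * g = x * z"
  shows "x \<in> nf_units K" "z \<in> nf_units K" "z - 1 \<in> m" "x - 1 \<in> fideal_mult n (ideal_inv m)"
proof -
  have G': "\<alpha> \<in> \<O>" "\<delta> \<in> \<O>" "g \<in> fideal_mult q n" "\<beta> \<in> ideal_inv q" "x * z \<in> nf_units K" "\<delta> - 1 \<in> n"
    using G by (simp_all add: Gamma_iff det)
  have g: "s * g \<in> n" if "s \<in> ideal_inv q" for s using qn_qi[OF G'(3) that] .
  \<comment> \<open>Testing on \<open>i * k\<close> with \<open>i = a * r + c * s\<close> produces
    \<open>a * x\<close> and \<open>c * x\<close>, which the eigenvector equations replace by
    entries of \<gamma>.\<close>
  have xO: "x \<in> \<O>"
  proof (rule ideal_cancel[OF frac_ideal_bi frac_ideal_O])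
    fix i k assume ik: "i \<in> bi" "k \<in> ideal_inv bi"
    then obtain r s where rs: "r \<in> \<O>" "s \<in> ideal_inv q" "i = a * r + c * s" by (auto simp: bi_iff)
    have "x * (i * k) = (a * x) * (r * k) + (c * x) * (s * k)" by (simp add: rs algebra_simps)
    also have "\<dots> = \<alpha> * (r * (k * a)) + r * (k * c * \<beta>) + (s * g) * (k * a) + \<delta> * (k * c * s)"
      unfolding x(1,2)[symmetric] by (simp add: algebra_simps)
    also have "\<dots> \<in> \<O>"
      by (intro add_O mult_O[OF G'(1)] mult_O[OF rs(1)] mult_O[OF n_O[OF g[OF rs(2)]]] mult_O[OF G'(2)]
          bi_inv[OF ik(2)] rs G')
    finally show "x * (i * k) \<in> \<O>" .
  qed
  have zO: "z \<in> \<O>"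
  proof (rule ideal_cancel[OF frac_ideal_bi frac_ideal_O])
    fix i k assume ik: "i \<in> bi" "k \<in> ideal_inv bi"
    then obtain r s where rs: "r \<in> \<O>" "s \<in> ideal_inv q" "i = a * r + c * s" by (auto simp: bi_iff)
    have "z * (i * k) = (z * a) * (r * k) + (z * c) * (s * k)" by (simp add: rs algebra_simps)
    also have "\<dots> = \<delta> * (r * (k * a)) - r * (k * c * \<beta>) - (s * g) * (k * a) + \<alpha> * (k * c * s)"
      unfolding z(1,2) by (simp add: algebra_simps)
    also have "\<dots> \<in> \<O>"
      by (intro add_O diff_O mult_O[OF G'(1)] mult_O[OF rs(1)] mult_O[OF n_O[OF g[OF rs(2)]]] mult_O[OF G'(2)]
          bi_inv[OF ik(2)] rs G')
    finally show "z * (i * k) \<in> \<O>" .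
  qed
  show "x \<in> nf_units K" using units_factor[OF xO zO] G' by simp
  show "z \<in> nf_units K" using units_factor[OF zO xO] G' by (simp add: mult.commute)
  obtain k l where kl: "k \<in> ideal_inv bi" "l \<in> qbi" "k * a + l * c = 1" by (rule bezout)
  \<comment> \<open>Only \<open>z * a\<close> is rewritten by the eigenvector equation, bringing in
    \<open>\<delta> - 1\<close>. The part with \<open>l * c\<close> already lies in c times
    \<open>qbi\<close>.\<close>
  have "z - 1 = (z - 1) * (k * a + l * c)" using kl by simp
  also have "\<dots> = k * (z * a) - k * a + (z - 1) * l * c" by (simp add: algebra_simps)
  also have "\<dots> = c * ((z - 1) * l - \<beta> * k) + (k * a) * (\<delta> - 1)"
    unfolding z(1) by (simp add: algebra_simps)
  finally have "z - 1 = c * ((z - 1) * l - \<beta> * k) + (k * a) * (\<delta> - 1)" .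
  moreover have "(z - 1) * l - \<beta> * k \<in> qbi"
    using ideal_inv_multI[OF G'(4) kl(1)]
    by (intro frac_ideal_diff[OF frac_ideal_qbi frac_idealD(5)[OF frac_ideal_qbi diff_O[OF zO one_O] kl(2)]])
      (simp add: qbi_def)
  moreover have "(k * a) * (\<delta> - 1) \<in> n" using bi_inv(1)[OF kl(1)] G' by (intro n_scale)
  ultimately show "z - 1 \<in> m" using m_iff by blast
  have c_part: "(x - 1) * (c * k) \<in> n" if k: "k \<in> qbi" for k
  proof (rule ideal_cancel[OF frac_ideal_q frac_ideal_n])
    fix i s assume il: "i \<in> q" "s \<in> ideal_inv q"
    have h: "k * i \<in> ideal_inv bi" using k il frac_ideal_q unfolding qbi_def by (intro ideal_inv_mult_right)
    have "(x - 1) * (c * k) * (i * s) = (c * x - c) * (k * i * s)" by (simp add: algebra_simps)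
    \<comment> \<open>The second eigenvector equation involves the lower row of \<gamma>, where
      \<open>s * g\<close> and \<open>\<delta> - 1\<close> both lie in n.\<close>
    also have "\<dots> = (k * i * a) * (s * g) + (k * i * c * s) * (\<delta> - 1)"
      unfolding x(2)[symmetric] by (simp add: algebra_simps)
    also have "\<dots> \<in> n" by (intro n_add n_scale[OF bi_inv(1)[OF h]] n_scale[OF bi_inv(2)[OF h]] il g G')
    finally show "(x - 1) * (c * k) * (i * s) \<in> n" .
  qed
  show "x - 1 \<in> fideal_mult n (ideal_inv m)"
  proof (rule mult_ideal_invI[OF frac_ideal_m frac_ideal_n])
    fix i assume "i \<in> m"
    then obtain k r where kr: "k \<in> qbi" "r \<in> n" "i = c * k + r" by (auto simp: m_iff)
    have "(x - 1) * (c * k) + (x - 1) * r \<in> n"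
      by (rule n_add[OF c_part[OF kr(1)] n_scale[OF diff_O[OF xO one_O] kr(2)]])
    then show "(x - 1) * i \<in> n" by (simp add: kr algebra_simps)
  qed
qed

text \<open>With \<open>k a + l c = 1\<close>, conjugate \<open>(x, y, 0, z)\<close> by the unimodular matrix
  \<open>(a, - l, c, k)\<close>; the congruence \<open>z - 1 = c w + r\<close> dictates \<open>y = - w k\<close>.\<close>
lemma eigenvalue_matrix:
  assumes x: "x \<in> nf_units K" "x - 1 \<in> fideal_mult n (ideal_inv m)"
    and z: "z \<in> nf_units K" "z - 1 \<in> m" and tp: "totally_positive K (x * z)"
  obtains \<alpha> \<beta> g \<delta> where "(\<alpha>, \<beta>, g, \<delta>) \<in> \<Gamma>"
    "\<alpha> * a + \<beta> * c = a * x" "g * a + \<delta> * c = c * x"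
    "z * a = a * \<delta> - c * \<beta>" "z * c = c * \<alpha> - a * g"
proof -
  have xO: "x \<in> \<O>" and zO: "z \<in> \<O>" using unitsD x z by auto
  obtain k l where kl: "k \<in> ideal_inv bi" "l \<in> qbi" "k * a + l * c = 1" by (rule bezout)
  obtain w r where wr: "w \<in> qbi" "r \<in> n" "z - 1 = c * w + r" using z(2) by (auto simp: m_iff)
  have x_m: "(x - 1) * i \<in> n" if "i \<in> m" for i
    using mult_ideal_inv_cancel[OF frac_ideal_n x(2) that] .
  have x_c: "(x - 1) * (c * h) \<in> n" if "h \<in> qbi" for h
  proof (rule x_m)
    have "c * h = c * h + 0" by simp
    then show "c * h \<in> m" using m_iff that frac_idealD(2)[OF frac_ideal_n] by blast
  qed
  define \<alpha> where "\<alpha> = (k * a) * x + (c * w) * (k * a) + (c * l) * z"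
  define \<beta> where "\<beta> = (x - z) * (a * l) - (k * a) * (a * w)"
  \<comment> \<open>The entries g and \<delta> are written through \<open>x - 1\<close> and
    \<open>r\<close> to expose their congruences: the choice of y replaces \<open>z - 1\<close> by
    its part \<open>r\<close> in n. The conjugation form returns below as \<open>g'\<close> and
    \<open>\<delta>'\<close>.\<close>
  define g where "g = (x - 1) * (k * c) - (k * c) * r"
  define \<delta> where "\<delta> = (x - 1) * (c * l) + (k * a) * r + 1"
  have ka: "k * a = 1 - l * c" using kl(3) by (simp add: algebra_simps)
  have r: "r = z - 1 - c * w" using wr(3) by simp
  have "\<alpha> \<in> \<O>" unfolding \<alpha>_def
    using kl wr xO zO by (intro add_O mult_O[OF mult_O[OF c_qbi_O]] mult_O c_qbi_O bi_inv)
  moreover have "\<beta> \<in> ideal_inv q" unfolding \<beta>_def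
    using kl wr xO zO by (intro qi_diff qi_scale[OF diff_O] qi_scale[OF bi_inv(1)] a_qbi)
  moreover have "\<delta> - 1 \<in> n" unfolding \<delta>_def
    using n_add[OF x_c[OF kl(2)] n_scale[OF bi_inv(1)[OF kl(1)] wr(2)]] by simp
  moreover have "\<delta> \<in> \<O>" using add_O[OF n_O[OF \<open>\<delta> - 1 \<in> n\<close>] one_O] by simp
  moreover have "(x - 1) * (k * c) \<in> fideal_mult q n"
  proof (rule ideal_cancel[OF frac_ideal_q frac_ideal_qn])
    fix i s assume il: "i \<in> q" "s \<in> ideal_inv q"
    have "s * k \<in> qbi" unfolding qbi_def using il kl by (intro ideal_inv_multI)
    then have "i * ((x - 1) * (c * (s * k))) \<in> fideal_mult q n" using il x_c by (intro fideal_multI)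
    then show "(x - 1) * (k * c) * (i * s) \<in> fideal_mult q n" by (simp add: mult_ac)
  qed
  then have "g \<in> fideal_mult q n" unfolding g_def
    by (rule frac_ideal_diff[OF frac_ideal_qn _ fideal_multI[OF bi_inv_q[OF kl(1)] wr(2)]])
  moreover have g': "g = c * k * (x - z) + c * c * w * k"
    unfolding g_def r by (simp add: algebra_simps)
  moreover have \<delta>': "\<delta> = c * x * l + a * k * z - a * c * w * k"
  proof -
    have "\<delta> = c * x * l + a * k * z - a * c * w * k + (1 - (k * a + l * c))"
      unfolding \<delta>_def r by (simp add: algebra_simps)
    then show ?thesis by (simp add: kl(3))
  qed
  moreover have "\<alpha> * \<delta> - \<beta> * g = x * z"
  proof -
    \<comment> \<open>Keeping the square of the determinant \<open>k * a + l * c\<close> makes this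
      a pure ring identity; the Bezout relation is applied only afterwards. The eigenvector
      equations below are treated the same way.\<close>
    have "\<alpha> * \<delta> - \<beta> * g = x * z * ((k * a + l * c) * (k * a + l * c))"
      unfolding \<alpha>_def \<beta>_def g' \<delta>' by (simp add: algebra_simps)
    then show ?thesis by (simp add: kl(3))
  qed
  ultimately have G: "(\<alpha>, \<beta>, g, \<delta>) \<in> \<Gamma>"
    unfolding Gamma_iff using tp units_mult[OF x(1) z(1)] by simp
  show ?thesis
  proof (rule that[OF G])
    have "\<alpha> * a + \<beta> * c = a * x * (k * a + l * c)"
      unfolding \<alpha>_def \<beta>_def by (simp add: algebra_simps)
    then show "\<alpha> * a + \<beta> * c = a * x" by (simp add: kl(3))
    have "g * a + \<delta> * c = c * x * (k * a + l * c)"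
      unfolding g' \<delta>' by (simp add: algebra_simps)
    then show "g * a + \<delta> * c = c * x" by (simp add: kl(3))
    have "a * \<delta> - c * \<beta> = z * a * (k * a + l * c)"
      unfolding \<beta>_def \<delta>' by (simp add: algebra_simps)
    then show "z * a = a * \<delta> - c * \<beta>" by (simp add: kl(3))
    have "c * \<alpha> - a * g = z * c * (k * a + l * c)"
      unfolding \<alpha>_def g' by (simp add: algebra_simps)
    then show "z * c = c * \<alpha> - a * g" by (simp add: kl(3))
  qed
qed

section \<open>The two implications\<close>

lemma fixed_coset_imp_not_admissible:
  assumes "(x, y, 0, z) \<in> GL2_plus K" "nf_norm K z < 0"
    and "left_coset \<Gamma> (mat2_mult (a, b, c, d) (x, y, 0, z)) = left_coset \<Gamma> (a, b, c, d)"
  shows "\<not> admissible_pair K m n"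
proof -
  have K: "x \<in> K" "y \<in> K" "z \<in> K" and tp: "totally_positive K (x * z)"
    using assms(1) by (simp_all add: GL2_plus_def)
  have "M \<in> left_coset \<Gamma> M" for M
    using Gamma_one mat2_mult_one[of M, symmetric] unfolding left_coset_def by blast
  then have "mat2_mult (a, b, c, d) (x, y, 0, z) \<in> left_coset \<Gamma> (a, b, c, d)"
    using assms(3) by blast
  then obtain L where "L \<in> \<Gamma>" "mat2_mult (a, b, c, d) (x, y, 0, z) = mat2_mult L (a, b, c, d)"
    unfolding left_coset_def by blast
  then obtain \<alpha> \<beta> g \<delta> where G: "(\<alpha>, \<beta>, g, \<delta>) \<in> \<Gamma>"
    and eq: "mat2_mult (a, b, c, d) (x, y, 0, z) = mat2_mult (\<alpha>, \<beta>, g, \<delta>) (a, b, c, d)"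
    by (cases L) blast
  have x: "\<alpha> * a + \<beta> * c = a * x" "g * a + \<delta> * c = c * x"
    and bd: "\<alpha> * b + \<beta> * d = a * y + b * z" "g * b + \<delta> * d = c * y + d * z"
    using eq by simp_all
  define D where "D = a * d - b * c"
  have D: "D \<noteq> 0" using A_det by (simp add: D_def)
  have "(\<alpha> * \<delta> - \<beta> * g) * D = (\<alpha> * a + \<beta> * c) * (g * b + \<delta> * d) - (\<alpha> * b + \<beta> * d) * (g * a + \<delta> * c)"
    by (simp add: D_def algebra_simps)
  also have "\<dots> = x * z * D" unfolding x bd by (simp add: D_def algebra_simps)
  finally have det: "\<alpha> * \<delta> - \<beta> * g = x * z" using D by simp
  \<comment> \<open>\<open>(P, Q)\<close> is the row \<open>(- c, a)\<close> times \<gamma>. Its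
    product with A is \<open>(0, z D)\<close>, and solving this system by Cramer's rule shows that
    it is z times \<open>(- c, a)\<close>.\<close>
  define P where "P = a * g - c * \<alpha>"
  define Q where "Q = a * \<delta> - c * \<beta>"
  have PQ: "P * a + Q * c = 0" "P * b + Q * d = z * D"
  proof -
    have "P * a + Q * c = a * (g * a + \<delta> * c) - c * (\<alpha> * a + \<beta> * c)"
      by (simp add: P_def Q_def algebra_simps)
    then show "P * a + Q * c = 0" unfolding x by simp
    have "P * b + Q * d = a * (g * b + \<delta> * d) - c * (\<alpha> * b + \<beta> * d)"
      by (simp add: P_def Q_def algebra_simps)
    then show "P * b + Q * d = z * D" unfolding bd by (simp add: D_def algebra_simps)
  qed
  have "Q * D = a * (P * b + Q * d) - b * (P * a + Q * c)" by (simp add: D_def algebra_simps)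
  then have "Q * D = (z * a) * D" unfolding PQ by (simp add: mult_ac)
  then have "Q = z * a" using D by simp
  have "P * D = d * (P * a + Q * c) - c * (P * b + Q * d)" by (simp add: D_def algebra_simps)
  then have "P * D = (- z * c) * D" unfolding PQ by (simp add: mult_ac)
  then have "P = - z * c" using D mult_right_cancel by blast
  have z: "z * a = a * \<delta> - c * \<beta>" "z * c = c * \<alpha> - a * g"
    using \<open>Q = z * a\<close> \<open>P = - z * c\<close> by (auto simp: Q_def P_def algebra_simps)
  note cong = eigenvalue_congruences[OF G x K(1) z K(3) det]
  have "nf_norm K z = - 1" using norm_unit[OF cong(2)] assms(2) by auto
  moreover have "nf_norm K x * nf_norm K z > 0"
    using norm_mult[OF K(1,3)] norm_totally_positive[OF tp] by simp
  then have "nf_norm K x = - 1" using norm_unit[OF cong(1)] assms(2) by (auto simp: zero_less_mult_iff)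
  moreover have "totally_positive K (z / x)"
  proof -
    have "x \<noteq> 0" using unitsD[OF cong(1)] by simp
    then have "totally_positive K (x * z * (inverse x * inverse x))"
      using tp K by (intro totally_positive_mult_square) (auto intro: inverse_K)
    moreover have "x * z * (inverse x * inverse x) = z / x" using \<open>x \<noteq> 0\<close> by (simp add: field_simps)
    ultimately show ?thesis by simp
  qed
  ultimately show ?thesis using cong unfolding admissible_pair_def cong_mod_def by blast
qed

lemma not_admissible_imp_fixed_coset:
  assumes "\<not> admissible_pair K m n"
  obtains x y z where "(x, y, 0, z) \<in> GL2_plus K" "nf_norm K z < 0"
    "left_coset \<Gamma> (mat2_mult (a, b, c, d) (x, y, 0, z)) = left_coset \<Gamma> (a, b, c, d)"
proof -
  obtain z x where z: "z \<in> nf_units K" "z - 1 \<in> m" "nf_norm K z = - 1"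
    and x: "x \<in> nf_units K" "x - 1 \<in> fideal_mult n (ideal_inv m)" and tp: "totally_positive K (z / x)"
    using assms by (auto simp: admissible_pair_def cong_mod_def)
  have "x \<noteq> 0" "x \<in> K" "z \<in> K" using unitsD x z by blast+
  then have "totally_positive K (z / x * (x * x))" using tp by (intro totally_positive_mult_square)
  then have tp: "totally_positive K (x * z)" using \<open>x \<noteq> 0\<close> by (simp add: mult.commute)
  obtain \<alpha> \<beta> g \<delta> where G: "(\<alpha>, \<beta>, g, \<delta>) \<in> \<Gamma>"
    and ev: "\<alpha> * a + \<beta> * c = a * x" "g * a + \<delta> * c = c * x"
      "z * a = a * \<delta> - c * \<beta>" "z * c = c * \<alpha> - a * g"
    using eigenvalue_matrix[OF x z(1,2) tp] by blast
  define D where "D = a * d - b * c"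
  have D: "D \<noteq> 0" using A_det by (simp add: D_def)
  define X where "X = \<alpha> * b + \<beta> * d"
  define Y where "Y = g * b + \<delta> * d"
  \<comment> \<open>The upper right entry of \<open>A^-1 \<gamma> A\<close>, given by Cramer's
    rule.\<close>
  define y where "y = (d * X - b * Y) / D"
  have yD: "y * D = d * X - b * Y" using D by (simp add: y_def)
  have "a * Y - c * X = d * (a * \<delta> - c * \<beta>) - b * (c * \<alpha> - a * g)"
    by (simp add: X_def Y_def algebra_simps)
  \<comment> \<open>The left eigenvector equations identify the lower right entry of
    \<open>A^-1 \<gamma> A\<close> as z.\<close>
  then have XY: "a * Y - c * X = z * D" unfolding ev(3,4)[symmetric] by (simp add: D_def algebra_simps)
  have "(a * y + b * z) * D = a * (y * D) + b * (z * D)" by (simp add: algebra_simps)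
  also have "\<dots> = X * D" unfolding yD XY[symmetric] by (simp add: D_def algebra_simps)
  finally have 1: "a * y + b * z = X" using D by simp
  have "(c * y + d * z) * D = c * (y * D) + d * (z * D)" by (simp add: algebra_simps)
  also have "\<dots> = Y * D" unfolding yD XY[symmetric] by (simp add: D_def algebra_simps)
  finally have 2: "c * y + d * z = Y" using D by simp
  have eq: "mat2_mult (a, b, c, d) (x, y, 0, z) = mat2_mult (\<alpha>, \<beta>, g, \<delta>) (a, b, c, d)"
    using ev(1,2) 1 2 by (simp add: X_def Y_def)
  have "\<alpha> \<in> K" "\<beta> \<in> K" "g \<in> K" "\<delta> \<in> K" using G by (simp_all add: Gamma1_def GL2_plus_def)
  then have "y \<in> K" unfolding y_def X_def Y_def D_def using A_K by (intro K_intros)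
  then have "(x, y, 0, z) \<in> GL2_plus K"
    using tp \<open>x \<in> K\<close> \<open>z \<in> K\<close> by (simp add: GL2_plus_def)
  moreover have "nf_norm K z < 0" using z by simp
  moreover obtain L' where "L' \<in> \<Gamma>" "mat2_mult L' (\<alpha>, \<beta>, g, \<delta>) = (1, 0, 0, 1)"
    using Gamma_inverse[OF G] by blast
  then have "left_coset \<Gamma> (mat2_mult (a, b, c, d) (x, y, 0, z)) = left_coset \<Gamma> (a, b, c, d)"
    unfolding eq using Gamma_mult G by (intro left_coset_mult_eq)
  ultimately show ?thesis by (rule that)
qed

end

end

theorem theorem3p3:
  fixes K :: "complex set" and n t :: "complex set" and A :: mat2
  assumes "number_field K" and "totally_real K"
    and "int_ideal K n"
    and "frac_ideal K t" and "coprime_to K t n"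
    and "A \<in> GL2_plus K"
  shows "(\<exists>x y z. (x, y, 0, z) \<in> GL2_plus K \<and> nf_norm K z < 0 \<and>
            left_coset (Gamma1 K t n) (mat2_mult A (x, y, 0, z)) = left_coset (Gamma1 K t n) A)
         \<longleftrightarrow> \<not> admissible K t n A"
proof -
  interpret level K n t
    using assms by unfold_locales
  obtain a b c d where A: "A = (a, b, c, d)" by (cases A)
  have GL: "(a, b, c, d) \<in> GL2_plus K" using assms(6) by (simp add: A)
  have "admissible K t n A \<longleftrightarrow> admissible_pair K (m a b c d) n"
    by (simp only: admissible_def A m_def[OF GL])
  then show ?thesis
    using fixed_coset_imp_not_admissible[OF GL] not_admissible_imp_fixed_coset[OF GL]
    unfolding A by metis
qed

end
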